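(* Let $K,L\subset\mathbb R^n$ be convex bodies such that $M(K,L)=|K\cap(-L)|$. Then $$|C_1(K,L)|\ \ge\ \binom{2n}{n}\frac1{n^n}\,\frac{|K|\,|L|}{M(K,L)}.$$ Equality holds if and only if $K=-L$ is a simplex.
   Context: A convex body in $\mathbb R^n$ is a compact convex set with non-empty interior; $|\cdot|$ denotes Lebesgue measure. $K+L$ is the Minkowski sum, $M(K,L)=\sup_{x\in K+L}|K\cap(x-L)|$, and for $\theta\in[0,1]$, $K+_\theta L=\{x\in K+L:\ |K\cap(x-L)|\ge\theta M(K,L)\}$. When $M(K,L)=|K\cap(-L)|$, the limiting convolution set is $C_1(K,L)=\lim_{\theta\to1^-}\frac{K+_\theta L}{1-\theta}$. The limit exists because the sets $\frac{K+_\theta L}{1-\theta^{1/n}}$ increase with $\theta\in[0,1)$ and $1-\theta\sim n(1-\theta^{1/n})$ as $\theta\to1^-$; that is, $C_1(K,L)=\frac1n\,\overline{\bigcup_{\theta\in[0,1)}\frac{K+_\theta L}{1-\theta^{1/n}}}$. This set may be unbounded, and its volume may be $+\infty$. *)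

theory Defs
  imports "HOL-Analysis.Analysis"
begin

definition convex_body :: "'a::euclidean_space set \<Rightarrow> bool" where
  "convex_body K \<longleftrightarrow> compact K \<and> convex K \<and> interior K \<noteq> {}"

text \<open>
  On sets, \<open>K + L\<close> is the Minkowski sum, whereas unary minus is the complement;
  hence reflections are written as images.
\<close>

definition conv_fun :: "'a::euclidean_space set \<Rightarrow> 'a set \<Rightarrow> 'a \<Rightarrow> real" where
  "conv_fun K L x = measure lebesgue (K \<inter> (\<lambda>y. x - y) ` L)"

definition max_conv :: "'a::euclidean_space set \<Rightarrow> 'a set \<Rightarrow> real" where
  "max_conv K L = (SUP x\<in>K + L. conv_fun K L x)"

definition theta_sum :: "real \<Rightarrow> 'a::euclidean_space set \<Rightarrow> 'a set \<Rightarrow> 'a set" where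
  "theta_sum \<theta> K L = {x \<in> K + L. conv_fun K L x \<ge> \<theta> * max_conv K L}"

text \<open>
  The limiting convolution set, i.e. the limit of \<open>(K +\<^sub>\<theta> L) / (1 - \<theta>)\<close> as \<open>\<theta>\<close> tends to 1 from
  below, written out as the closed union of the increasing family
  \<open>(K +\<^sub>\<theta> L) / (1 - \<theta>\<^bsup>1/n\<^esup>)\<close> scaled by \<open>1/n\<close>, because \<open>1 - \<theta> \<sim> n (1 - \<theta>\<^bsup>1/n\<^esup>)\<close>.
  It is meaningful when \<open>max_conv K L\<close> is attained at the origin; it may be unbounded.
\<close>

definition limit_conv_set :: "'a::euclidean_space set \<Rightarrow> 'a set \<Rightarrow> 'a set" where
  "limit_conv_set K L =
     (\<lambda>x. x /\<^sub>R real DIM('a)) `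
       closure (\<Union>\<theta>\<in>{0..<1}. (\<lambda>x. x /\<^sub>R (1 - root DIM('a) \<theta>)) ` theta_sum \<theta> K L)"

end

theory Submission
  imports Defs
begin

text \<open>
  Put \<open>N = -L\<close>, \<open>f x = |K \<inter> (x + N)|\<close>, \<open>M = f 0\<close>, \<open>D = K - N\<close> and let \<open>C = n C\<^sub>1(K,L)\<close>.
  By definition \<open>{f \<ge> s\<^sup>n M} \<subseteq> (1 - s) C\<close>, so the layer-cake formula gives
  \<open>|K| |N| = \<integral> f = M \<integral>\<^sub>0\<^sup>1 n s\<^bsup>n-1\<^esup> |{f \<ge> s\<^sup>n M}| ds \<le> M |C| n B(n, n+1)\<close>, which is the inequality.

  In general \<open>(1 - s) D \<subseteq> {f \<ge> s\<^sup>n M}\<close>, because \<open>K \<inter> (r x + N)\<close> contains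
  \<open>(1 - r) (K \<inter> N) + r p\<close> for every \<open>p \<in> K \<inter> (x + N)\<close>. Equality in the theorem forces
  equality in both inclusions, hence \<open>f (r x) = (1 - r)\<^sup>n M\<close> for \<open>x\<close> on the boundary of \<open>D\<close>, and
  \<open>K \<inter> (r x + N)\<close> is exactly that homothet of \<open>K \<inter> N\<close>, whichever \<open>p\<close> is chosen; no equality case
  of the Brunn-Minkowski inequality is needed. These homotheties exclude boundary points of \<open>K\<close>
  inside \<open>N\<close> and vice versa, so \<open>K = N\<close>. They also turn the cone over \<open>K\<close> into a lattice, at least
  as far as extreme rays are concerned, and Riesz decomposition makes the extreme points of \<open>K\<close>
  affinely independent. For a simplex, barycentric coordinates show that both inclusions are
  equalities.
\<close>

section \<open>Bodies with homothetic overlaps\<close>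

definition difference_body :: "'a::euclidean_space set \<Rightarrow> 'a set \<Rightarrow> 'a set" where
  "difference_body K N = {k - m |k m. k \<in> K \<and> m \<in> N}"

lemma difference_body_iff: "x \<in> difference_body K N \<longleftrightarrow> K \<inter> (+) x ` N \<noteq> {}"
  unfolding difference_body_def by (force simp: algebra_simps)

lemma mem_plus_image_iff: "y \<in> (+) x ` N \<longleftrightarrow> y - x \<in> N" for x :: "'a::euclidean_space"
  by (force simp: image_iff algebra_simps)

lemma compact_difference_body:
  "compact K \<Longrightarrow> compact N \<Longrightarrow> compact (difference_body K N)"
  unfolding difference_body_def using compact_differences[of K N] by simp

lemma convex_difference_body:
  "convex K \<Longrightarrow> convex N \<Longrightarrow> convex (difference_body K N)"
proof -
  have "difference_body K N = (\<Union>x\<in>K. \<Union>y\<in>N. {x - y})"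
    by (auto simp: difference_body_def)
  then show "convex K \<Longrightarrow> convex N \<Longrightarrow> convex (difference_body K N)"
    by (simp add: convex_differences)
qed

lemma zero_in_interior_difference_body:
  fixes K N :: "'a::euclidean_space set"
  assumes "interior (K \<inter> N) \<noteq> {}"
  shows "0 \<in> interior (difference_body K N)"
proof -
  obtain a where a: "a \<in> interior (K \<inter> N)" using assms by auto
  have "(\<lambda>x. x - a) ` interior (K \<inter> N) \<subseteq> difference_body K N"
    using interior_subset[of "K \<inter> N"] a by (auto simp: difference_body_def)
  moreover have "open ((\<lambda>x. x - a) ` interior (K \<inter> N))"
    by (intro open_translation_subtract open_interior)
  moreover have "0 \<in> (\<lambda>x. x - a) ` interior (K \<inter> N)" using a by force
  ultimately show ?thesis by (meson interior_maximal subsetD)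
qed

lemma difference_body_uminus:
  "difference_body N K = uminus ` difference_body K N"
  by (force simp: difference_body_def image_iff)

text \<open>Here \<open>p\<close> is the point at which \<open>K\<close> and \<open>x + N\<close> touch.\<close>

definition homothetic_overlaps :: "'a::euclidean_space set \<Rightarrow> 'a set \<Rightarrow> bool" where
  "homothetic_overlaps K N \<longleftrightarrow>
     (\<forall>x\<in>frontier (difference_body K N). \<exists>p. K \<inter> (+) x ` N = {p} \<and>
        (\<forall>r\<in>{0<..<1}. K \<inter> (+) (r *\<^sub>R x) ` N = (\<lambda>a. (1 - r) *\<^sub>R a + r *\<^sub>R p) ` (K \<inter> N)))"

lemma homothetic_overlapsE:
  assumes "homothetic_overlaps K N" "x \<in> frontier (difference_body K N)"
  obtains p where "K \<inter> (+) x ` N = {p}"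
    "\<And>r. 0 < r \<Longrightarrow> r < 1 \<Longrightarrow>
       K \<inter> (+) (r *\<^sub>R x) ` N = (\<lambda>a. (1 - r) *\<^sub>R a + r *\<^sub>R p) ` (K \<inter> N)"
  using assms unfolding homothetic_overlaps_def by (metis greaterThanLessThan_iff)

section \<open>Homothetic overlaps force the two bodies to coincide\<close>

lemma overlap_swap: "N \<inter> (+) (- x) ` K = (\<lambda>y. y - x) ` (K \<inter> (+) x ` N)"
  for x :: "'a::euclidean_space"
  by (force simp: image_iff algebra_simps)

lemma frontier_uminus: "frontier (uminus ` S) = uminus ` frontier S"
  for S :: "'a::euclidean_space set"
  using closure_injective_linear_image[of uminus S]
  by (simp add: frontier_def interior_negations image_set_diff linear_uminus)

text \<open>Exchanging the bodies replaces \<open>x\<close> by \<open>-x\<close>, and the touching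
  point moves from \<open>p\<close> to \<open>p + x\<close>. This symmetry reduces
  \<open>K = N\<close> to one inclusion.\<close>

lemma homothetic_overlaps_swap:
  assumes "homothetic_overlaps K N"
  shows "homothetic_overlaps N K"
  unfolding homothetic_overlaps_def
proof
  fix x assume "x \<in> frontier (difference_body N K)"
  then have "- x \<in> frontier (difference_body K N)"
    by (auto simp: difference_body_uminus[of N K] frontier_uminus)
  then obtain p where p: "K \<inter> (+) (- x) ` N = {p}"
    "\<And>r. 0 < r \<Longrightarrow> r < 1 \<Longrightarrow>
       K \<inter> (+) (r *\<^sub>R (- x)) ` N = (\<lambda>a. (1 - r) *\<^sub>R a + r *\<^sub>R p) ` (K \<inter> N)"
    using homothetic_overlapsE[OF assms] by metis
  have "N \<inter> (+) x ` K = {p + x}"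
    using overlap_swap[of N "- x" K] p(1) by simp
  moreover have "N \<inter> (+) (r *\<^sub>R x) ` K = (\<lambda>a. (1 - r) *\<^sub>R a + r *\<^sub>R (p + x)) ` (N \<inter> K)"
    if "0 < r" "r < 1" for r
    using overlap_swap[of N "r *\<^sub>R (- x)" K] p(2)[OF that]
    by (simp add: image_image algebra_simps Int_commute)
  ultimately show "\<exists>p. N \<inter> (+) x ` K = {p} \<and>
        (\<forall>r\<in>{0<..<1}. N \<inter> (+) (r *\<^sub>R x) ` K = (\<lambda>a. (1 - r) *\<^sub>R a + r *\<^sub>R p) ` (N \<inter> K))"
    by auto
qed

text \<open>Let a functional \<open>u\<close> support \<open>K\<close> from below at a boundary
  point \<open>a\<close> of \<open>K\<close> interior to \<open>N\<close>. With \<open>k\<close>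
  maximal on \<open>K\<close> and \<open>m\<close> minimal on \<open>N\<close>, the difference
  \<open>k - m\<close> is maximal on the difference body, so it lies on the frontier, and the
  touching point is \<open>k\<close>. After a small shift \<open>N\<close> still covers
  \<open>a\<close>, which puts \<open>a\<close> into a homothet of \<open>K \<inter> N\<close> with
  centre \<open>k\<close>. Then \<open>u\<close> cannot be larger at \<open>k\<close> than at
  \<open>a\<close>, and \<open>K\<close> would be flat.\<close>

lemma homothetic_overlaps_frontier_disjoint:
  fixes K N :: "'a::euclidean_space set"
  assumes K: "compact K" "convex K" "interior K \<noteq> {}" and N: "compact N"
    and hom: "homothetic_overlaps K N"
  shows "interior N \<inter> frontier K = {}"
proof (rule ccontr)
  assume "interior N \<inter> frontier K \<noteq> {}"
  then obtain a where a: "a \<in> interior N" "a \<in> frontier K" by auto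
  have aK: "a \<in> K" using a K frontier_subset_compact by blast
  have "a \<notin> rel_interior K"
    using a K by (simp add: frontier_def interior_rel_interior_gen rel_interior_nonempty_interior)
  then obtain u where u: "u \<noteq> 0" "\<And>y. y \<in> K \<Longrightarrow> u \<bullet> a \<le> u \<bullet> y"
    using supporting_hyperplane_rel_boundary[OF K(2) aK] by metis
  obtain k where k: "k \<in> K" "\<And>y. y \<in> K \<Longrightarrow> u \<bullet> y \<le> u \<bullet> k"
    using continuous_attains_sup[of K "\<lambda>y. u \<bullet> y"] K aK
    by (metis continuous_on_inner[OF continuous_on_const continuous_on_id] empty_iff)
  have "a \<in> N" using a interior_subset by auto
  then obtain m where m: "m \<in> N" "\<And>y. y \<in> N \<Longrightarrow> u \<bullet> m \<le> u \<bullet> y"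
    using continuous_attains_inf[of N "\<lambda>y. u \<bullet> y"] N
    by (metis continuous_on_inner[OF continuous_on_const continuous_on_id] empty_iff)
  define D where "D = difference_body K N"
  have x_max: "u \<bullet> y \<le> u \<bullet> (k - m)" if "y \<in> D" for y
    using that k m by (force simp: D_def difference_body_def inner_diff_right intro: diff_mono)
  have xD: "k - m \<in> D" using k m by (auto simp: D_def difference_body_def)
  have "k - m \<notin> interior D"
  proof
    assume "k - m \<in> interior D"
    then obtain e where e: "0 < e" "ball (k - m) e \<subseteq> D"
      by (meson mem_interior)
    have "k - m + (e / 2 / norm u) *\<^sub>R u \<in> ball (k - m) e"
      using e u by (simp add: dist_norm)
    then have "u \<bullet> (k - m + (e / 2 / norm u) *\<^sub>R u) \<le> u \<bullet> (k - m)"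
      using e x_max by blast
    then have "(e / 2 / norm u) * (u \<bullet> u) \<le> 0" by (simp add: inner_add_right)
    moreover have "(e / 2 / norm u) * (u \<bullet> u) > 0"
      using e u by simp
    ultimately show False by simp
  qed
  then have xF: "k - m \<in> frontier D"
    using xD closure_subset by (auto simp: frontier_def)
  then obtain p where p: "K \<inter> (+) (k - m) ` N = {p}"
    "\<And>r. 0 < r \<Longrightarrow> r < 1 \<Longrightarrow>
       K \<inter> (+) (r *\<^sub>R (k - m)) ` N = (\<lambda>a. (1 - r) *\<^sub>R a + r *\<^sub>R p) ` (K \<inter> N)"
    using homothetic_overlapsE[OF hom] unfolding D_def by metis
  have "k \<in> K \<inter> (+) (k - m) ` N" using k m by (auto simp: mem_plus_image_iff)
  then have pk: "p = k" using p(1) by auto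
  obtain e where e: "0 < e" "ball a e \<subseteq> N" using a(1) by (meson mem_interior)
  obtain r where r: "0 < r" "r < 1" "r * norm (k - m) < e"
  proof
    \<comment> \<open>The summand \<open>1\<close> keeps the denominator positive even for
      \<open>k = m\<close>, where division by zero would return \<open>0\<close>.\<close>
    let ?r = "min (1/2) (e / (2 * (norm (k - m) + 1)))"
    have pos: "0 < norm (k - m) + 1" by (smt (verit) norm_ge_zero)
    show "0 < ?r" "?r < 1" using e pos by auto
    have "?r * norm (k - m) \<le> e / (2 * (norm (k - m) + 1)) * (norm (k - m) + 1)"
      by (rule mult_mono) (use e pos in auto)
    also have "\<dots> = e / 2"
      using pos by (metis (no_types) less_irrefl mult.commute nonzero_mult_divide_mult_cancel_right
          times_divide_eq_left)
    finally show "?r * norm (k - m) < e" using e by linarith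
  qed
  have "a - r *\<^sub>R (k - m) \<in> N"
    using r e(2) by (auto simp: dist_norm intro!: subsetD[OF e(2)])
  then have "a \<in> (\<lambda>a. (1 - r) *\<^sub>R a + r *\<^sub>R k) ` (K \<inter> N)"
    using p(2)[OF r(1,2)] aK pk by (auto simp: mem_plus_image_iff)
  then obtain a' where a': "a' \<in> K" "a = (1 - r) *\<^sub>R a' + r *\<^sub>R k" by auto
  then have "u \<bullet> a = (1 - r) * (u \<bullet> a') + r * (u \<bullet> k)" by (simp add: inner_add_right)
  moreover have "(1 - r) * (u \<bullet> a) \<le> (1 - r) * (u \<bullet> a')"
    using u(2)[OF a'(1)] r by (intro mult_left_mono) auto
  ultimately have "r * (u \<bullet> k) \<le> r * (u \<bullet> a)" by (simp add: algebra_simps)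
  then have "u \<bullet> k \<le> u \<bullet> a" using r by simp
  then have "u \<bullet> y = u \<bullet> a" if "y \<in> K" for y using u(2)[OF that] k(2)[OF that] by simp
  then have "K \<subseteq> {y. u \<bullet> y = u \<bullet> a}" by auto
  then have "interior K \<subseteq> interior {y. u \<bullet> y = u \<bullet> a}" by (rule interior_mono)
  then show False using K(3) u(1) interior_hyperplane[of u] by auto
qed

text \<open>The interior of \<open>N\<close> is connected, meets \<open>K\<close> and avoids the
  frontier of \<open>K\<close>, so it lies in \<open>K\<close>; taking closures gives one inclusion,
  and the other follows by exchanging the bodies.\<close>

lemma homothetic_overlaps_imp_eq:
  fixes K N :: "'a::euclidean_space set"
  assumes K: "compact K" "convex K" and N: "compact N" "convex N"
    and int: "interior (K \<inter> N) \<noteq> {}" and hom: "homothetic_overlaps K N"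
  shows "K = N"
proof -
  have sub: "N \<subseteq> K" if "compact K" "convex K" "compact N" "convex N"
    "interior (K \<inter> N) \<noteq> {}" "homothetic_overlaps K N" for K N :: "'a set"
  proof -
    have ne: "interior K \<noteq> {}" "interior N \<noteq> {}" "interior N \<inter> K \<noteq> {}"
      using that(5) interior_subset by auto
    have "interior N \<inter> frontier K = {}"
      using homothetic_overlaps_frontier_disjoint that ne by blast
    moreover have "connected (interior N)" using that convex_connected convex_interior by blast
    ultimately have "interior N - K = {}"
      using connected_Int_frontier ne by metis
    then have "closure (interior N) \<subseteq> K"
      using that by (metis Diff_eq_empty_iff closure_minimal compact_imp_closed)
    then show ?thesis
      using that ne by (metis convex_closure_interior closure_closed compact_imp_closed)
  qed
  show ?thesis
    using sub[of K N] sub[of N K] assms homothetic_overlaps_swap[OF hom]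
    by (simp add: Int_commute)
qed

section \<open>Extreme points and the order of the cone over a body\<close>

text \<open>The open segment from an interior point to a point of the closure stays in the interior,
  and \<open>x\<close> lies on the segment from \<open>0\<close> to \<open>t *\<^sub>R x\<close> at
  parameter \<open>1/t\<close>.\<close>

lemma scaled_frontier_notin_closure:
  fixes D :: "'a::euclidean_space set"
  assumes "convex D" "0 \<in> interior D" "x \<in> frontier D" "1 < t"
  shows "t *\<^sub>R x \<notin> closure D"
proof
  assume "t *\<^sub>R x \<in> closure D"
  then have seg: "open_segment 0 (t *\<^sub>R x) \<subseteq> interior D"
    using in_interior_closure_convex_segment assms by blast
  have "x \<noteq> 0" using assms by (auto simp: frontier_def)
  then have "x \<in> open_segment 0 (t *\<^sub>R x)"
    using assms(4) by (auto simp: in_segment intro!: exI[of _ "1/t"])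
  then show False using seg assms(3) by (auto simp: frontier_def)
qed

text \<open>Let \<open>t \<ge> 1\<close> be the factor that carries \<open>a - b\<close> to the
  frontier, and \<open>p\<close> the touching point there. If \<open>t > 1\<close>, the overlap for
  \<open>a - b\<close> is a homothet of \<open>K\<close> with centre \<open>p\<close> and contains
  \<open>a\<close>. Extremality of \<open>a\<close> forces \<open>p = a\<close>, and then
  \<open>b\<close> lies strictly between \<open>a\<close> and
  \<open>a - t *\<^sub>R (a - b)\<close>, both points of \<open>K\<close>. Hence
  \<open>t = 1\<close>.\<close>

lemma homothetic_overlaps_extreme_points:
  fixes K :: "'a::euclidean_space set"
  assumes K: "compact K" "convex K" "interior K \<noteq> {}" and hom: "homothetic_overlaps K K"
    and a: "a extreme_point_of K" and b: "b extreme_point_of K" and "a \<noteq> b"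
  shows "a - b \<in> frontier (difference_body K K)"
    and "K \<inter> (+) (a - b) ` K = {a}"
    and "\<And>r. 0 < r \<Longrightarrow> r < 1 \<Longrightarrow>
       K \<inter> (+) (r *\<^sub>R (a - b)) ` K = (\<lambda>k. (1 - r) *\<^sub>R k + r *\<^sub>R a) ` K"
proof -
  define D where "D = difference_body K K"
  have D: "compact D" "convex D" "0 \<in> interior D"
    unfolding D_def using K
    by (auto intro: compact_difference_body convex_difference_body zero_in_interior_difference_body)
  have abK: "a \<in> K" "b \<in> K" using a b by (auto simp: extreme_point_of_def)
  have "a - b \<noteq> 0" using \<open>a \<noteq> b\<close> by simp
  then obtain t where t: "0 < t" "t *\<^sub>R (a - b) \<in> frontier D"
    using ray_to_frontier[of D 0 "a - b"] D compact_imp_bounded by (metis add_0)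
  have "a - b \<in> D" unfolding D_def difference_body_def using abK by auto
  then have "a - b \<in> closure D" using closure_subset by auto
  then have "1 \<le> t"
    using scaled_frontier_notin_closure[OF D(2,3) t(2), of "1/t"] t(1)
    by (cases "t < 1") (auto simp: field_simps)
  from t obtain p where p: "K \<inter> (+) (t *\<^sub>R (a - b)) ` K = {p}"
    "\<And>r. 0 < r \<Longrightarrow> r < 1 \<Longrightarrow>
       K \<inter> (+) (r *\<^sub>R (t *\<^sub>R (a - b))) ` K = (\<lambda>a. (1 - r) *\<^sub>R a + r *\<^sub>R p) ` (K \<inter> K)"
    using homothetic_overlapsE[OF hom] unfolding D_def by metis
  have pK: "p \<in> K" "p - t *\<^sub>R (a - b) \<in> K" 
  proof -
    have "p \<in> K \<inter> (+) (t *\<^sub>R (a - b)) ` K" unfolding p(1) by simp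
    then show "p \<in> K" "p - t *\<^sub>R (a - b) \<in> K" unfolding Int_iff mem_plus_image_iff by auto
  qed
  have t1: "t = 1"
  proof (rule ccontr)
    assume "t \<noteq> 1"
    with \<open>1 \<le> t\<close> have t: "1 < t" by simp
    have "a \<in> K \<inter> (+) ((1/t) *\<^sub>R (t *\<^sub>R (a - b))) ` K"
      using t abK by (auto simp: mem_plus_image_iff)
    also have "\<dots> = (\<lambda>k. (1 - 1/t) *\<^sub>R k + (1/t) *\<^sub>R p) ` (K \<inter> K)"
      by (rule p(2)) (use t in auto)
    finally obtain k where k: "k \<in> K" "a = (1 - 1/t) *\<^sub>R k + (1/t) *\<^sub>R p" by auto
    have kp: "k = p"
    proof (rule ccontr)
      assume "k \<noteq> p"
      then have "a \<in> open_segment k p" using k(2) t by (auto simp: in_segment intro!: exI[of _ "1/t"])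
      then show False using a k(1) pK by (auto simp: extreme_point_of_def)
    qed
    then have "a = p" using k by (simp flip: scaleR_add_left)
    then have "b = (1 - 1/t) *\<^sub>R a + (1/t) *\<^sub>R (a - t *\<^sub>R (a - b))"
      using t by (simp add: algebra_simps)
    moreover have "a \<noteq> a - t *\<^sub>R (a - b)" using t \<open>a \<noteq> b\<close> by simp
    ultimately have "b \<in> open_segment a (a - t *\<^sub>R (a - b))"
      unfolding in_segment using t by (intro conjI exI[of _ "1/t"]) auto
    then show False using b abK pK \<open>a = p\<close> by (auto simp: extreme_point_of_def)
  qed
  have "a \<in> K \<inter> (+) (a - b) ` K" using abK by (auto simp: mem_plus_image_iff)
  then have "p = a" using p(1) t1 by auto
  then show "a - b \<in> frontier (difference_body K K)" "K \<inter> (+) (a - b) ` K = {a}"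
    "\<And>r. 0 < r \<Longrightarrow> r < 1 \<Longrightarrow>
       K \<inter> (+) (r *\<^sub>R (a - b)) ` K = (\<lambda>k. (1 - r) *\<^sub>R k + r *\<^sub>R a) ` K"
    using t p t1 unfolding D_def by auto
qed


text \<open>
  Homogenised, this is the lattice identity \<open>\<epsilon>a \<squnion> \<epsilon>b = \<epsilon>a + \<epsilon>b\<close> in the order of the cone over \<open>K\<close>;
  \<open>t\<close> is the height in the cone.
\<close>

lemma homothetic_overlaps_cone_sup:
  fixes K :: "'a::euclidean_space set"
  assumes K: "compact K" "convex K" "interior K \<noteq> {}" and hom: "homothetic_overlaps K K"
    and a: "a extreme_point_of K" and b: "b extreme_point_of K" and "a \<noteq> b"
    and \<epsilon>: "0 < \<epsilon>" "\<epsilon> \<le> t"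
    and y: "y \<in> K" "z = \<epsilon> *\<^sub>R a + (t - \<epsilon>) *\<^sub>R y"
    and w: "w \<in> K" "z = \<epsilon> *\<^sub>R b + (t - \<epsilon>) *\<^sub>R w"
  shows "2 * \<epsilon> \<le> t \<and> (\<exists>k\<in>K. z = \<epsilon> *\<^sub>R a + \<epsilon> *\<^sub>R b + (t - 2 * \<epsilon>) *\<^sub>R k)"
proof -
  note ext = homothetic_overlaps_extreme_points[OF K hom a b \<open>a \<noteq> b\<close>]
  have "\<epsilon> \<noteq> t" using y w \<open>a \<noteq> b\<close> \<epsilon> by auto
  then have t: "0 < t - \<epsilon>" using \<epsilon> by simp
  \<comment> \<open>Both \<open>w\<close> and \<open>y\<close> are remainders at height
    \<open>t - \<epsilon>\<close>; dividing by this height turns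
    \<open>\<epsilon> *\<^sub>R (a - b)\<close> into
    \<open>w - y = r *\<^sub>R (a - b)\<close>.\<close>
  define r where "r = \<epsilon> / (t - \<epsilon>)"
  have r: "0 < r" "(t - \<epsilon>) * r = \<epsilon>" using t \<epsilon> by (auto simp: r_def)
  have "(t - \<epsilon>) *\<^sub>R w = (t - \<epsilon>) *\<^sub>R y + ((t - \<epsilon>) * r) *\<^sub>R (a - b)"
    unfolding r(2) using y(2) w(2) by (simp add: algebra_simps)
  then have "(t - \<epsilon>) *\<^sub>R w = (t - \<epsilon>) *\<^sub>R (y + r *\<^sub>R (a - b))" by (simp add: scaleR_add_right)
  then have wy: "w = y + r *\<^sub>R (a - b)" using t by (simp del: scaleR_add_right)
  then have mem: "w \<in> K \<inter> (+) (r *\<^sub>R (a - b)) ` K"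
    using y w by (simp add: mem_plus_image_iff)
  \<comment> \<open>\<open>w - y\<close> lies in the difference body, whereas \<open>a - b\<close>
    is already on its frontier.\<close>
  have "r \<le> 1"
  proof (rule ccontr)
    assume "\<not> r \<le> 1"
    then have "r *\<^sub>R (a - b) \<notin> closure (difference_body K K)"
      using ext(1) K
      by (intro scaled_frontier_notin_closure convex_difference_body zero_in_interior_difference_body) auto
    moreover have "r *\<^sub>R (a - b) \<in> difference_body K K"
      using mem by (auto simp: difference_body_iff)
    ultimately show False using closure_subset by blast
  qed
  \<comment> \<open>The homothety is available for \<open>r < 1\<close>; for \<open>r = 1\<close>
    the overlap is the single point \<open>a\<close>.\<close>
  obtain k where k: "k \<in> K" "w = (1 - r) *\<^sub>R k + r *\<^sub>R a"
  proof (cases "r = 1")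
    case True
    then have "w = a" using mem ext(2) by simp
    then show ?thesis using that[of w] w True by simp
  next
    case False
    then show ?thesis using ext(3)[of r] mem r \<open>r \<le> 1\<close> that by auto
  qed
  have "(t - \<epsilon>) *\<^sub>R w = ((t - \<epsilon>) - (t - \<epsilon>) * r) *\<^sub>R k + ((t - \<epsilon>) * r) *\<^sub>R a"
    unfolding k(2) by (simp add: algebra_simps)
  then have "z = \<epsilon> *\<^sub>R b + ((t - \<epsilon> - \<epsilon>) *\<^sub>R k + \<epsilon> *\<^sub>R a)"
    unfolding r(2) using w(2) by simp
  then have "z = \<epsilon> *\<^sub>R a + \<epsilon> *\<^sub>R b + (t - 2 * \<epsilon>) *\<^sub>R k"
    by (simp add: algebra_simps)
  moreover have "2 * \<epsilon> \<le> t"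
    using mult_left_mono[OF \<open>r \<le> 1\<close>, of "t - \<epsilon>"] r(2) t by simp
  ultimately show ?thesis using k by blast
qed

text \<open>Induction on \<open>m\<close>, peeling off one copy of
  \<open>\<epsilon> *\<^sub>R b\<close>: the single-copy case places it beside
  \<open>\<epsilon> *\<^sub>R a\<close>, and what is left of \<open>z\<close> has height
  \<open>t - \<epsilon>\<close> and still dominates both \<open>\<epsilon> *\<^sub>R a\<close> and
  the other \<open>m\<close> copies.\<close>

lemma homothetic_overlaps_cone_sup_multiple:
  fixes K :: "'a::euclidean_space set" and t \<epsilon> :: real
  assumes K: "compact K" "convex K" "interior K \<noteq> {}" and hom: "homothetic_overlaps K K"
    and a: "a extreme_point_of K" and b: "b extreme_point_of K" and "a \<noteq> b"
    and \<epsilon>: "0 < \<epsilon>" "\<epsilon> \<le> t" "real m * \<epsilon> \<le> t"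
    and y: "y \<in> K" "z = \<epsilon> *\<^sub>R a + (t - \<epsilon>) *\<^sub>R y"
    and w: "w \<in> K" "z = (m * \<epsilon>) *\<^sub>R b + (t - m * \<epsilon>) *\<^sub>R w"
  shows "Suc m * \<epsilon> \<le> t \<and> (\<exists>k\<in>K. z = \<epsilon> *\<^sub>R a + (m * \<epsilon>) *\<^sub>R b + (t - Suc m * \<epsilon>) *\<^sub>R k)"
  using \<epsilon> y w
proof (induction m arbitrary: t y z)
  case 0
  then show ?case by auto
next
  case (Suc m)
  have bK: "b \<in> K" using b by (simp add: extreme_point_of_def)
  obtain w' where w': "w' \<in> K" "z = \<epsilon> *\<^sub>R b + (t - \<epsilon>) *\<^sub>R w'"
  proof (cases "t = \<epsilon>")
    case True
    have "real m * \<epsilon> \<le> 0" using Suc.prems(3) True by (simp add: algebra_simps)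
    then have "m = 0" using Suc.prems(1) by (simp add: mult_le_0_iff)
    then show ?thesis using Suc.prems that True by simp
  next
    case False
    then have t: "0 < t - \<epsilon>" using Suc.prems by simp
    \<comment> \<open>The remaining \<open>m\<close> copies of \<open>b\<close> together with the
      part of \<open>w\<close>, normalised to total weight one.\<close>
    define v where "v = (m * \<epsilon> / (t - \<epsilon>)) *\<^sub>R b + ((t - Suc m * \<epsilon>) / (t - \<epsilon>)) *\<^sub>R w"
    have "m * \<epsilon> / (t - \<epsilon>) + (t - Suc m * \<epsilon>) / (t - \<epsilon>) = (m * \<epsilon> + (t - Suc m * \<epsilon>)) / (t - \<epsilon>)"
      by (rule add_divide_distrib[symmetric])
    also have "\<dots> = 1" using t by (simp add: distrib_right)
    finally have "v \<in> K" unfolding v_def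
      using Suc.prems bK t by (intro convexD[OF K(2)]) auto
    moreover have "(t - \<epsilon>) *\<^sub>R v = (m * \<epsilon>) *\<^sub>R b + (t - Suc m * \<epsilon>) *\<^sub>R w"
      using t unfolding v_def scaleR_add_right scaleR_scaleR by simp
    then have "z = \<epsilon> *\<^sub>R b + (t - \<epsilon>) *\<^sub>R v"
      using Suc.prems(7) by (simp add: distrib_right scaleR_add_left)
    ultimately show ?thesis using that by blast
  qed
  obtain k where k: "2 * \<epsilon> \<le> t" "k \<in> K" "z = \<epsilon> *\<^sub>R a + \<epsilon> *\<^sub>R b + (t - 2 * \<epsilon>) *\<^sub>R k"
    using homothetic_overlaps_cone_sup[OF K hom a b \<open>a \<noteq> b\<close> Suc.prems(1,2,4,5) w'] by blast
  have "Suc m * \<epsilon> \<le> t - \<epsilon> \<and>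
    (\<exists>k\<in>K. z - \<epsilon> *\<^sub>R b = \<epsilon> *\<^sub>R a + (m * \<epsilon>) *\<^sub>R b + ((t - \<epsilon>) - Suc m * \<epsilon>) *\<^sub>R k)"
  proof (rule Suc.IH)
    show "z - \<epsilon> *\<^sub>R b = \<epsilon> *\<^sub>R a + (t - \<epsilon> - \<epsilon>) *\<^sub>R k"
      unfolding k(3) by (simp add: algebra_simps)
    show "k \<in> K" "\<epsilon> \<le> t - \<epsilon>" "0 < \<epsilon>" using k Suc.prems by simp_all
    show "real m * \<epsilon> \<le> t - \<epsilon>" using Suc.prems(3) by (simp add: algebra_simps)
    show "w \<in> K" "z - \<epsilon> *\<^sub>R b = (m * \<epsilon>) *\<^sub>R b + (t - \<epsilon> - m * \<epsilon>) *\<^sub>R w"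
      using Suc.prems(6,7) by (simp_all add: algebra_simps)
  qed
  then obtain k where "Suc m * \<epsilon> \<le> t - \<epsilon>" "k \<in> K"
    "z - \<epsilon> *\<^sub>R b = \<epsilon> *\<^sub>R a + (m * \<epsilon>) *\<^sub>R b + ((t - \<epsilon>) - Suc m * \<epsilon>) *\<^sub>R k" by blast
  then show ?case by (intro conjI bexI[of _ k]) (simp_all add: algebra_simps)
qed

lemma extreme_point_decomposition:
  assumes "b extreme_point_of K" "a \<in> K" "y \<in> K" "0 < \<epsilon>" "\<epsilon> \<le> 1"
    and eq: "b = \<epsilon> *\<^sub>R a + (1 - \<epsilon>) *\<^sub>R y"
  shows "a = b"
proof (rule ccontr)
  assume "a \<noteq> b"
  then have "\<epsilon> \<noteq> 1" "y \<noteq> a" using eq by (auto simp flip: scaleR_add_left)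
  then have "b \<in> open_segment y a"
    using assms by (auto simp: in_segment add.commute intro!: exI[of _ \<epsilon>])
  then show False using assms by (auto simp: extreme_point_of_def)
qed

text \<open>Riesz decomposition: a vertex that is part of \<open>z\<close> must be among the vertices spanning \<open>z\<close>.\<close>

lemma homothetic_overlaps_hull_extreme_points:
  fixes K :: "'a::euclidean_space set"
  assumes K: "compact K" "convex K" "interior K \<noteq> {}" and hom: "homothetic_overlaps K K"
    and a: "a extreme_point_of K" and S: "finite S" "\<And>b. b \<in> S \<Longrightarrow> b extreme_point_of K"
    and z: "z \<in> convex hull S" "y \<in> K" "0 < \<epsilon>" "\<epsilon> \<le> 1" "z = \<epsilon> *\<^sub>R a + (1 - \<epsilon>) *\<^sub>R y"
  shows "a \<in> S"
  using S z
proof (induction S arbitrary: z y \<epsilon> rule: finite_induct)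
  case empty
  then show ?case by simp
next
  case (insert b S)
  have aK: "a \<in> K" using a by (simp add: extreme_point_of_def)
  have b: "b extreme_point_of K" using insert.prems by simp
  show ?case
  proof (rule ccontr)
    assume "a \<notin> insert b S"
    then have ab: "a \<noteq> b" "a \<notin> S" by auto
    have b': False if "z = b"
      using extreme_point_decomposition[OF b aK insert.prems(3-5)] insert.prems(6) that ab by auto
    have "S \<noteq> {}" using insert.prems b' by auto
    then obtain \<beta> v w where w: "0 \<le> \<beta>" "0 \<le> v" "\<beta> + v = 1" "w \<in> convex hull S"
      "z = \<beta> *\<^sub>R b + v *\<^sub>R w"
      using insert.prems(2) unfolding convex_hull_insert[OF \<open>S \<noteq> {}\<close>] by auto
    have v: "v = 1 - \<beta>" using w by simp
    have "S \<subseteq> K" using insert.prems(1) by (auto simp: extreme_point_of_def)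
    then have wK: "w \<in> K" using w K hull_minimal by (metis subsetD)
    have \<beta>: "0 < \<beta>"
    proof (rule ccontr)
      assume "\<not> 0 < \<beta>"
      then have "z = w" using w by simp
      then have "a \<in> S"
        by (intro insert.IH) (use w insert.prems in auto)
      then show False using ab by simp
    qed
    have \<beta>1: "\<beta> < 1" using w b' v by (cases "\<beta> = 1") auto
    \<comment> \<open>The weights \<open>\<epsilon>\<close> of \<open>a\<close> and
      \<open>\<beta>\<close> of \<open>b\<close> are brought to a common unit
      \<open>\<delta> = \<beta> / m\<close>: \<open>\<beta>\<close> is an exact multiple of it, and
      \<open>m\<close> is large enough for \<open>\<delta> \<le> \<epsilon>\<close>.\<close>
    obtain m :: nat where m: "\<beta> / \<epsilon> < m" using reals_Archimedean2 by blast
    have m0: "0 < m"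
    proof -
      have "0 < \<beta> / \<epsilon>" using \<beta> insert.prems by simp
      then show ?thesis using m by (smt (verit) of_nat_0_less_iff)
    qed
    define \<delta> where "\<delta> = \<beta> / m"
    have \<delta>: "0 < \<delta>" "\<delta> \<le> \<epsilon>" "m * \<delta> = \<beta>"
      using \<beta> m m0 insert.prems unfolding \<delta>_def by (auto simp: field_simps)
    have "\<delta> \<le> 1" using \<delta> insert.prems by linarith
    obtain y' where y': "y' \<in> K" "z = \<delta> *\<^sub>R a + (1 - \<delta>) *\<^sub>R y'"
    proof (cases "\<delta> = 1")
      case True
      then have "\<epsilon> = 1" using \<delta> insert.prems by simp
      then show ?thesis using that[of y] True insert.prems by simp
    next
      case False
      then have d: "0 < 1 - \<delta>" using \<open>\<delta> \<le> 1\<close> by simp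
      \<comment> \<open>The surplus weight \<open>\<epsilon> - \<delta>\<close> of \<open>a\<close>
        is absorbed into the remainder.\<close>
      define y' where "y' = ((\<epsilon> - \<delta>) / (1 - \<delta>)) *\<^sub>R a + ((1 - \<epsilon>) / (1 - \<delta>)) *\<^sub>R y"
      have "y' \<in> K" unfolding y'_def
        by (rule convexD[OF K(2) aK insert.prems(3)]) (use d \<delta> insert.prems in \<open>auto simp: field_simps\<close>)
      moreover have "(1 - \<delta>) *\<^sub>R y' = (\<epsilon> - \<delta>) *\<^sub>R a + (1 - \<epsilon>) *\<^sub>R y"
        using d unfolding y'_def scaleR_add_right scaleR_scaleR by simp
      then have "z = \<delta> *\<^sub>R a + (1 - \<delta>) *\<^sub>R y'"
        using insert.prems(6) by (simp add: scaleR_left_diff_distrib)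
      ultimately show ?thesis using that by blast
    qed
    have "Suc m * \<delta> \<le> 1 \<and> (\<exists>k\<in>K. z = \<delta> *\<^sub>R a + (m * \<delta>) *\<^sub>R b + (1 - Suc m * \<delta>) *\<^sub>R k)"
      by (rule homothetic_overlaps_cone_sup_multiple[OF K hom a b ab(1) \<delta>(1) \<open>\<delta> \<le> 1\<close> _ y' wK])
         (use \<delta> \<beta>1 w v in auto)
    then obtain k where k: "Suc m * \<delta> \<le> 1" "k \<in> K"
      "z = \<delta> *\<^sub>R a + \<beta> *\<^sub>R b + (1 - Suc m * \<delta>) *\<^sub>R k" using \<delta>(3) by auto
    have sm: "Suc m * \<delta> = \<beta> + \<delta>" using \<delta>(3) by (simp add: algebra_simps)
    \<comment> \<open>Removing the \<open>b\<close>-part from both decompositions of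
      \<open>z\<close> leaves \<open>a\<close> as a part of \<open>w\<close>, which lies in the hull
      of the smaller set \<open>S\<close>.\<close>
    have "(1 - \<beta>) *\<^sub>R w = \<delta> *\<^sub>R a + (1 - \<beta> - \<delta>) *\<^sub>R k"
      using w(5) k(3) unfolding v sm by (simp add: algebra_simps)
    then have "(1 / (1 - \<beta>)) *\<^sub>R ((1 - \<beta>) *\<^sub>R w) =
        (1 / (1 - \<beta>)) *\<^sub>R (\<delta> *\<^sub>R a + (1 - \<beta> - \<delta>) *\<^sub>R k)" by (rule arg_cong)
    then have "w = (\<delta> / (1 - \<beta>)) *\<^sub>R a + (1 - \<delta> / (1 - \<beta>)) *\<^sub>R k"
      using \<beta>1 unfolding scaleR_add_right scaleR_scaleR by (simp add: diff_divide_distrib)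
    then have "a \<in> S"
      using k sm \<delta> \<beta>1 insert.prems(1) w by (intro insert.IH[of w k "\<delta> / (1 - \<beta>)"]) auto
    then show False using ab by simp
  qed
qed

text \<open>An affine dependence among extreme points gives, by Radon's theorem, disjoint sets whose
  hulls share a point \<open>z\<close>. A vertex with positive weight on one side is a part of
  \<open>z\<close>, so Riesz decomposition puts it on the other side too. The number of vertices
  then follows from the dimension.\<close>

theorem homothetic_overlaps_imp_simplex:
  fixes K :: "'a::euclidean_space set"
  assumes K: "compact K" "convex K" "interior K \<noteq> {}" and hom: "homothetic_overlaps K K"
  shows "int DIM('a) simplex K"
proof -
  define E where "E = {x. x extreme_point_of K}"
  have KE: "K = convex hull E" unfolding E_def using Krein_Milman_Minkowski K by blast
  have "\<not> affine_dependent E"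
  proof
    assume "affine_dependent E"
    then obtain S T where ST: "S \<subseteq> E" "T \<subseteq> E" "S \<inter> T = {}" "convex hull S \<inter> convex hull T \<noteq> {}"
      using Radon by metis
    then obtain z where z: "z \<in> convex hull S" "z \<in> convex hull T" by auto
    \<comment> \<open>\<open>E\<close> is not known to be finite; Caratheodory's theorem passes to
      finite subsets.\<close>
    obtain T' where T': "finite T'" "T' \<subseteq> T" "z \<in> convex hull T'"
      using z(2) unfolding caratheodory[of T] by blast
    obtain S' where S': "finite S'" "S' \<subseteq> S" "z \<in> convex hull S'"
      using z(1) unfolding caratheodory[of S] by blast
    obtain c where c: "\<And>v. v \<in> S' \<Longrightarrow> 0 \<le> c v" "sum c S' = 1" "(\<Sum>v\<in>S'. c v *\<^sub>R v) = z"
      using S'(3) unfolding convex_hull_finite[OF S'(1)] by auto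
    obtain a where a: "a \<in> S'" "c a \<noteq> 0" using c(2) by (metis sum.neutral zero_neq_one)
    have S'K: "S' \<subseteq> K" using S' ST by (auto simp: E_def extreme_point_of_def)
    have ca: "0 < c a" using c(1)[OF a(1)] a(2) by simp
    have rest: "sum c (S' - {a}) = 1 - c a" using c(2) S'(1) a(1) by (simp add: sum_diff1)
    have pos: "0 \<le> sum c (S' - {a})" by (rule sum_nonneg) (use c in auto)
    have z_split: "z = c a *\<^sub>R a + (\<Sum>v\<in>S'-{a}. c v *\<^sub>R v)"
      using c(3) sum.remove[OF S'(1) a(1), of "\<lambda>v. c v *\<^sub>R v"] by simp
    obtain y where y: "y \<in> K" "z = c a *\<^sub>R a + (1 - c a) *\<^sub>R y"
    proof (cases "c a = 1")
      case True
      then have "sum c (S' - {a}) = 0" using rest by simp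
      then have "\<forall>v\<in>S'-{a}. c v = 0"
        using c(1) S'(1) by (subst (asm) sum_nonneg_eq_0_iff) auto
      then show ?thesis using that[of a] z_split True a S'K by auto
    next
      case False
      then have d: "0 < 1 - c a" using rest pos by simp
      have "(\<Sum>v\<in>S'-{a}. (c v / (1 - c a)) *\<^sub>R v) \<in> K"
      proof (rule convex_sum)
        show "(\<Sum>v\<in>S' - {a}. c v / (1 - c a)) = 1"
          using rest d by (simp flip: sum_divide_distrib)
      qed (use S'(1) S'K c(1) d K in auto)
      moreover have "(1 - c a) *\<^sub>R (\<Sum>v\<in>S'-{a}. (c v / (1 - c a)) *\<^sub>R v) = (\<Sum>v\<in>S'-{a}. c v *\<^sub>R v)"
        using d by (simp add: scaleR_sum_right)
      ultimately show ?thesis using that z_split by metis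
    qed
    have "a \<in> T'"
      by (rule homothetic_overlaps_hull_extreme_points[OF K hom _ T'(1) _ T'(3) y(1) ca _ y(2)])
         (use a ST S' T' rest pos in \<open>auto simp: E_def\<close>)
    then show False using a(1) S'(2) T'(2) ST(3) by auto
  qed
  moreover have "int (card E) = int DIM('a) + 1"
  proof -
    have "aff_dim K = int DIM('a)" using aff_dim_nonempty_interior K by blast
    then show ?thesis
      using aff_dim_affine_independent[OF \<open>\<not> affine_dependent E\<close>] KE by (simp add: aff_dim_convex_hull)
  qed
  ultimately show ?thesis unfolding simplex_def using KE by blast
qed

section \<open>Overlaps of translated simplices\<close>

lemma affine_independent_sum_eq:
  fixes V :: "'a::real_vector set"
  assumes "finite V" "\<not> affine_dependent V" "sum c V = sum d V"
    "(\<Sum>v\<in>V. c v *\<^sub>R v) = (\<Sum>v\<in>V. d v *\<^sub>R v)" "v \<in> V"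
  shows "c v = d v"
proof (rule ccontr)
  assume "c v \<noteq> d v"
  then have "affine_dependent V"
    unfolding affine_dependent_explicit_finite[OF assms(1)] using assms
    by (intro exI[of _ "\<lambda>v. c v - d v"]) (auto simp: sum_subtractf scaleR_left_diff_distrib)
  then show False using assms by simp
qed

text \<open>
  In barycentric coordinates \<open>\<xi>\<close> of \<open>x\<close> (summing to \<open>0\<close>), a point of \<open>K \<inter> (x + K)\<close> has
  coordinates at least the positive part of \<open>\<xi>\<close>; the remaining mass is \<open>r\<close>.
\<close>

lemma simplex_overlap:
  fixes K :: "'a::euclidean_space set"
  assumes "m simplex K" and x: "x \<in> difference_body K K"
  obtains r p where "0 \<le> r" "r \<le> 1" "K \<inter> (+) x ` K \<subseteq> (\<lambda>k. r *\<^sub>R k + p) ` K"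
    "x \<in> (*\<^sub>R) (1 - r) ` difference_body K K"
proof -
  obtain V where V: "finite V" "\<not> affine_dependent V" "K = convex hull V"
    using assms(1) unfolding simplex by blast
  have K: "K = {y. \<exists>c. (\<forall>v\<in>V. 0 \<le> c v) \<and> sum c V = 1 \<and> (\<Sum>v\<in>V. c v *\<^sub>R v) = y}"
    unfolding V(3) by (rule convex_hull_finite[OF V(1)])
  \<comment> \<open>Nonnegative coefficients of total mass \<open>s\<close> describe a point of
    \<open>s K\<close>. In the case \<open>s = 0\<close> a witness exists because \<open>x\<close>
    shows \<open>K\<close> to be nonempty.\<close>
  have cK: "\<exists>k\<in>K. (\<Sum>v\<in>V. c v *\<^sub>R v) = s *\<^sub>R k"
    if "\<forall>v\<in>V. 0 \<le> c v" "sum c V = s" for c s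
  proof (cases "s = 0")
    case True
    then have "\<forall>v\<in>V. c v = 0" using that V(1) sum_nonneg_eq_0_iff[of V c] by auto
    then show ?thesis using True x by (auto simp: difference_body_def)
  next
    case False
    have s: "0 < s" using False that sum_nonneg[of V c] by auto
    have "(\<Sum>v\<in>V. (c v / s) *\<^sub>R v) \<in> K"
      unfolding K using that s by (auto intro!: exI[of _ "\<lambda>v. c v / s"] simp flip: sum_divide_distrib)
    moreover have "(\<Sum>v\<in>V. c v *\<^sub>R v) = s *\<^sub>R (\<Sum>v\<in>V. (c v / s) *\<^sub>R v)"
      using s by (simp add: scaleR_sum_right)
    ultimately show ?thesis by blast
  qed
  obtain k1 k2 where k: "k1 \<in> K" "k2 \<in> K" "x = k1 - k2" using x by (auto simp: difference_body_def)
  obtain c d where c: "\<forall>v\<in>V. 0 \<le> c v" "sum c V = 1" "(\<Sum>v\<in>V. c v *\<^sub>R v) = k1"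
    and d: "\<forall>v\<in>V. 0 \<le> d v" "sum d V = 1" "(\<Sum>v\<in>V. d v *\<^sub>R v) = k2"
    using k(1,2) unfolding K by blast
  define \<xi> where "\<xi> v = c v - d v" for v
  have \<xi>: "sum \<xi> V = 0" "(\<Sum>v\<in>V. \<xi> v *\<^sub>R v) = x"
    using c d k by (auto simp: \<xi>_def sum_subtractf scaleR_left_diff_distrib)
  define \<xi>p where "\<xi>p v = max 0 (\<xi> v)" for v
  define \<xi>m where "\<xi>m v = max 0 (- \<xi> v)" for v
  have \<xi>_split: "\<xi> v = \<xi>p v - \<xi>m v" for v by (auto simp: \<xi>p_def \<xi>m_def)
  define r where "r = 1 - sum \<xi>p V"
  have "sum \<xi>p V \<le> sum c V" by (rule sum_mono) (use c d in \<open>auto simp: \<xi>p_def \<xi>_def\<close>)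
  moreover have "0 \<le> sum \<xi>p V" by (rule sum_nonneg) (auto simp: \<xi>p_def)
  ultimately have r: "0 \<le> r" "r \<le> 1" using c by (auto simp: r_def)
  have "K \<inter> (+) x ` K \<subseteq> (\<lambda>k. r *\<^sub>R k + (\<Sum>v\<in>V. \<xi>p v *\<^sub>R v)) ` K"
  proof
    fix y assume "y \<in> K \<inter> (+) x ` K"
    then obtain b e where b: "\<forall>v\<in>V. 0 \<le> b v" "sum b V = 1" "(\<Sum>v\<in>V. b v *\<^sub>R v) = y"
      and e: "\<forall>v\<in>V. 0 \<le> e v" "sum e V = 1" "x + (\<Sum>v\<in>V. e v *\<^sub>R v) = y"
      unfolding K by auto
    have "b v = \<xi> v + e v" if "v \<in> V" for v
      by (rule affine_independent_sum_eq[OF V(1,2) _ _ that])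
         (use b e \<xi> in \<open>auto simp: sum.distrib scaleR_add_left\<close>)
    \<comment> \<open>\<open>b = \<xi> + e\<close> with \<open>b\<close> and \<open>e\<close>
      nonnegative, so \<open>b\<close> dominates the positive part of \<open>\<xi>\<close>.\<close>
    then have "\<forall>v\<in>V. 0 \<le> b v - \<xi>p v" using b e by (auto simp: \<xi>p_def)
    moreover have "(\<Sum>v\<in>V. b v - \<xi>p v) = r" using b by (simp add: sum_subtractf r_def)
    ultimately obtain k where "k \<in> K" "(\<Sum>v\<in>V. (b v - \<xi>p v) *\<^sub>R v) = r *\<^sub>R k"
      using cK[of "\<lambda>v. b v - \<xi>p v" r] by auto
    then have "y = r *\<^sub>R k + (\<Sum>v\<in>V. \<xi>p v *\<^sub>R v)"
      using b(3) by (simp add: scaleR_left_diff_distrib sum_subtractf algebra_simps)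
    then show "y \<in> (\<lambda>k. r *\<^sub>R k + (\<Sum>v\<in>V. \<xi>p v *\<^sub>R v)) ` K" using \<open>k \<in> K\<close> by blast
  qed
  moreover have "x \<in> (*\<^sub>R) (1 - r) ` difference_body K K"
  proof -
    \<comment> \<open>As \<open>\<xi>\<close> sums to zero, its positive and negative parts have the
      same mass \<open>1 - r\<close>.\<close>
    have "sum \<xi>m V = 1 - r" using \<xi>(1) by (simp add: \<xi>_split sum_subtractf r_def)
    then obtain l2 where l2: "l2 \<in> K" "(\<Sum>v\<in>V. \<xi>m v *\<^sub>R v) = (1 - r) *\<^sub>R l2"
      using cK[of \<xi>m "1 - r"] by (auto simp: \<xi>m_def)
    obtain l1 where l1: "l1 \<in> K" "(\<Sum>v\<in>V. \<xi>p v *\<^sub>R v) = (1 - r) *\<^sub>R l1"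
      using cK[of \<xi>p "1 - r"] by (auto simp: \<xi>p_def r_def)
    have "x = (1 - r) *\<^sub>R (l1 - l2)"
      using \<xi>(2) l1(2) l2(2) by (simp add: \<xi>_split scaleR_left_diff_distrib sum_subtractf scaleR_right_diff_distrib)
    then show ?thesis using l1 l2 by (auto simp: difference_body_def)
  qed
  ultimately show ?thesis using r that by blast
qed

section \<open>The volume inequality and its equality case\<close>

lemma emeasure_lebesgue_borel: "A \<in> sets borel \<Longrightarrow> emeasure lebesgue A = emeasure lborel A"
  by (simp add: emeasure_completion)

lemma emeasure_lebesgue_reflect:
  fixes S :: "'a::euclidean_space set"
  shows "emeasure lebesgue ((\<lambda>y. x - y) ` S) = emeasure lebesgue S"
  using emeasure_lebesgue_affine[of "-1" x S] by simp

lemma measure_lebesgue_homothety: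
  fixes S :: "'a::euclidean_space set"
  assumes "0 \<le> r"
  shows "measure lebesgue ((\<lambda>a. r *\<^sub>R a + p) ` S) = r ^ DIM('a) * measure lebesgue S"
  using measure_lebesgue_affine[of r p S] assms by simp

lemma emeasure_lebesgue_scaling:
  fixes S :: "'a::euclidean_space set"
  assumes "0 \<le> r"
  shows "emeasure lebesgue ((*\<^sub>R) r ` S) = ennreal (r ^ DIM('a)) * emeasure lebesgue S"
  using emeasure_lebesgue_affine[of r 0 S] assms by (simp add: ennreal_power)

text \<open>\<open>interior T - S\<close> is open and null, hence empty, and a convex set with
  interior points lies in the closure of its interior.\<close>

lemma convex_subset_of_null_diff:
  fixes S T :: "'a::euclidean_space set"
  assumes "convex T" "interior T \<noteq> {}" "closed S" "negligible (T - S)"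
  shows "T \<subseteq> S"
proof -
  have "open (interior T - S)" using assms by blast
  moreover have "negligible (interior T - S)"
    using assms(4) interior_subset by (metis Diff_mono negligible_subset order_refl)
  ultimately have "interior T - S = {}" using open_not_negligible by blast
  then have "closure (interior T) \<subseteq> S" using assms(3) by (simp add: closure_minimal)
  then show ?thesis using assms convex_closure_interior closure_subset by blast
qed

lemma convex_eq_of_measure_le:
  fixes S T :: "'a::euclidean_space set"
  assumes "convex T" "interior T \<noteq> {}" "compact S" "compact T" "S \<subseteq> T"
    and "measure lebesgue T \<le> measure lebesgue S"
  shows "T = S"
proof -
  have m: "S \<in> lmeasurable" "T \<in> lmeasurable" using assms by (auto intro: lmeasurable_compact)
  have "measure lebesgue (T - S) = measure lebesgue T - measure lebesgue S"
    using m assms(5) by (simp add: measurable_measure_Diff fmeasurableD)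
  then have "measure lebesgue (T - S) = 0"
    using assms(6) measure_nonneg[of lebesgue "T - S"] by linarith
  then have "negligible (T - S)"
    using m by (metis fmeasurable.Diff negligible_iff_measure)
  then show ?thesis
    using convex_subset_of_null_diff assms compact_imp_closed by blast
qed

text \<open>A point of \<open>S\<close> that is extremal in direction \<open>v\<close> would be
  moved further out by a nonzero \<open>v\<close>.\<close>

lemma compact_translation_eqD:
  fixes S :: "'a::euclidean_space set"
  assumes "compact S" "S \<noteq> {}" "(+) v ` S = S"
  shows "v = 0"
proof -
  obtain m where m: "m \<in> S" "\<And>y. y \<in> S \<Longrightarrow> v \<bullet> y \<le> v \<bullet> m"
    using continuous_attains_sup[of S "\<lambda>y. v \<bullet> y"] assms
    by (metis continuous_on_inner[OF continuous_on_const continuous_on_id])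
  have "v + m \<in> S" using m(1) assms(3) by blast
  from m(2)[OF this] have "v \<bullet> v \<le> 0" by (simp add: inner_add_right)
  then show ?thesis using inner_gt_zero_iff[of v] by linarith
qed

section \<open>The layer-cake weight and its Beta integral\<close>

text \<open>The derivative of \<open>s ^ n\<close> on the open unit interval. Heights are written as
  \<open>s ^ n\<close>, so that the levels can be compared with sets shrinking linearly in
  \<open>s\<close>.\<close>

abbreviation layer_weight :: "nat \<Rightarrow> real \<Rightarrow> ennreal" where
  "layer_weight n s \<equiv> ennreal (real n * s ^ (n - 1)) * indicator {0<..<1} s"

lemma nn_integral_layer_weight:
  assumes "0 < n" "0 \<le> c" "c \<le> 1"
  shows "(\<integral>\<^sup>+s. layer_weight n s * indicator {s. s ^ n \<le> c} s \<partial>lborel)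
           = ennreal c"
proof -
  define r where "r = root n c"
  have r: "0 \<le> r" "r \<le> 1" "r ^ n = c"
    using assms by (auto simp: r_def)
  \<comment> \<open>The endpoints are discarded: the weight lives on the open interval, whereas the
    fundamental theorem of calculus is applied on \<open>{0..r}\<close>.\<close>
  have "AE s in lborel. s \<noteq> 0 \<and> s \<noteq> (1::real)"
    by (intro AE_conjI AE_lborel_singleton)
  then have "(\<integral>\<^sup>+s. layer_weight n s * indicator {s. s ^ n \<le> c} s \<partial>lborel)
    = (\<integral>\<^sup>+s. ennreal (real n * s ^ (n - 1)) * indicator {0..r} s \<partial>lborel)"
  proof (intro nn_integral_cong_AE, elim AE_mp, intro AE_I2 impI)
    fix s :: real assume s: "s \<noteq> 0 \<and> s \<noteq> 1"
    have "s ^ n \<le> c \<longleftrightarrow> s \<le> r" if "0 < s"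
      using that r assms(1) power_mono_iff[of s r n] by simp
    then show "layer_weight n s * indicator {s. s ^ n \<le> c} s
       = ennreal (real n * s ^ (n - 1)) * indicator {0..r} s"
      using s r by (auto simp: indicator_def)
  qed
  also have "\<dots> = ennreal (r ^ n - 0 ^ n)"
    by (rule nn_integral_FTC_Icc) (use r in \<open>auto intro!: derivative_eq_intros\<close>)
  finally show ?thesis using r assms(1) by (simp add: power_0_left)
qed

text \<open>The integral is \<open>n B(n, n+1) = n! n! / (2n)!\<close>, which is the source of the
  binomial coefficient.\<close>

lemma nn_integral_layer_weight_Beta:
  assumes "0 < n"
  shows "(\<integral>\<^sup>+s. layer_weight n s * ennreal ((1 - s) ^ n) \<partial>lborel)
           = ennreal (1 / real ((2 * n) choose n))"
proof -
  have B: "real n * Beta (real n) (real n + 1) = 1 / real ((2 * n) choose n)"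
  proof -
    obtain m where m: "n = Suc m" using assms gr0_implies_Suc by blast
    have "Gamma (real n) = fact m" using Gamma_fact[of m, where 'a=real] m by (simp add: add.commute)
    moreover have "Gamma (real n + 1) = fact n"
      using Gamma_fact[of n, where 'a=real] by (simp add: add.commute)
    moreover have "Gamma (real n + (real n + 1)) = fact (2 * n)"
      using Gamma_fact[of "2 * n", where 'a=real] by (simp add: add.commute add.left_commute)
    ultimately have "real n * Beta (real n) (real n + 1) = fact n * fact n / fact (2 * n)"
      unfolding Beta_def using m by (simp add: algebra_simps)
    also have "\<dots> = 1 / real ((2 * n) choose n)"
      by (simp add: binomial_fact)
    finally show ?thesis .
  qed
  have "((\<lambda>t. t powr (real n - 1) * (1 - t) powr ((real n + 1) - 1)) has_integral Beta (real n) (real n + 1)) {0<..<1}"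
    using has_integral_Beta_real[of "real n" "real n + 1"] assms by (simp add: has_integral_Icc_iff_Ioo)
  then have "((\<lambda>t. real n * (t powr (real n - 1) * (1 - t) powr ((real n + 1) - 1))) has_integral
      real n * Beta (real n) (real n + 1)) {0<..<1}"
    by (rule has_integral_mult_right)
  also have "?this \<longleftrightarrow> ((\<lambda>t. real n * t ^ (n - 1) * (1 - t) ^ n) has_integral
      real n * Beta (real n) (real n + 1)) {0<..<1}"
  proof (rule has_integral_cong)
    fix t :: real assume t: "t \<in> {0<..<1}"
    have "t powr (real n - 1) = t powr real (n - 1)" using assms by (simp add: of_nat_diff)
    then show "real n * (t powr (real n - 1) * (1 - t) powr ((real n + 1) - 1)) = real n * t ^ (n - 1) * (1 - t) ^ n"
      using t by (simp add: powr_realpow)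
  qed
  finally have "((\<lambda>t. if t \<in> {0<..<1} then real n * t ^ (n - 1) * (1 - t) ^ n else 0) has_integral
      1 / real ((2 * n) choose n)) UNIV"
    unfolding B by (subst has_integral_restrict_UNIV)
  then have "integral\<^sup>N lborel (\<lambda>t. ennreal (if t \<in> {0<..<1} then real n * t ^ (n - 1) * (1 - t) ^ n else 0))
      = ennreal (1 / real ((2 * n) choose n))"
    by (intro nn_integral_has_integral_lborel) auto
  also have "integral\<^sup>N lborel (\<lambda>t. ennreal (if t \<in> {0<..<1} then real n * t ^ (n - 1) * (1 - t) ^ n else 0))
      = (\<integral>\<^sup>+s. layer_weight n s * ennreal ((1 - s) ^ n) \<partial>lborel)"
    by (intro nn_integral_cong) (auto simp: indicator_def ennreal_mult)
  finally show ?thesis .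
qed

lemma AE_eq_of_nn_integral_eq:
  assumes "f \<in> borel_measurable M" "g \<in> borel_measurable M" "\<And>x. f x \<le> g x"
    and "integral\<^sup>N M f = integral\<^sup>N M g" "integral\<^sup>N M g < \<infinity>"
  shows "AE x in M. f x = (g x :: ennreal)"
proof -
  have "(\<integral>\<^sup>+ x. g x - f x \<partial>M) = integral\<^sup>N M g - integral\<^sup>N M f"
    by (rule nn_integral_diff) (use assms in auto)
  also have "\<dots> = 0" using assms by (simp add: ennreal_minus_eq_0)
  finally have "AE x in M. g x - f x = 0"
    using assms by (subst (asm) nn_integral_0_iff_AE) auto
  then show ?thesis
    by (rule AE_mp) (use assms(3) in \<open>auto simp: ennreal_minus_eq_0 intro!: AE_I2 antisym\<close>)
qed

section \<open>Overlap volumes and their level sets\<close>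

text \<open>\<open>N\<close> stands for \<open>-L\<close>, which turns \<open>K + L\<close> into the
  difference body and \<open>conv_fun\<close> into the volume of \<open>K \<inter> (x + N)\<close>;
  the maximum of this volume is attained at the origin.\<close>

locale overlap_max =
  fixes K N :: "'a::euclidean_space set"
  assumes compact_K: "compact K" and convex_K: "convex K"
    and compact_N: "compact N" and convex_N: "convex N"
    and max_pos: "0 < measure lebesgue (K \<inter> N)"
    and overlap_le: "measure lebesgue (K \<inter> (+) x ` N) \<le> measure lebesgue (K \<inter> N)"
begin

abbreviation "D \<equiv> difference_body K N"

abbreviation "M \<equiv> measure lebesgue (K \<inter> N)"

definition overlap :: "'a \<Rightarrow> real" where
  "overlap x = measure lebesgue (K \<inter> (+) x ` N)"

text \<open>\<open>s\<close> is the \<open>n\<close>-th root of the relative height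
  \<open>\<theta>\<close>, and \<open>level 0\<close> is \<open>D\<close>.\<close>

definition level :: "real \<Rightarrow> 'a set" where
  "level s = {x \<in> D. s ^ DIM('a) * M \<le> overlap x}"

text \<open>This is \<open>n\<close> times the limiting convolution set.\<close>

definition rescaled_levels :: "'a set" where
  "rescaled_levels = closure (\<Union>s\<in>{0..<1}. (\<lambda>x. x /\<^sub>R (1 - s)) ` level s)"

lemma compact_overlap: "compact (K \<inter> (+) x ` N)"
  using compact_K compact_N by (simp add: compact_Int compact_translation)

lemma convex_overlap: "convex (K \<inter> (+) x ` N)"
  using convex_K convex_N by (simp add: convex_Int convex_translation)

lemma compact_Int_KN: "compact (K \<inter> N)"
  using compact_K compact_N by (rule compact_Int)

lemma overlap_nonneg: "0 \<le> overlap x"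
  by (simp add: overlap_def)

lemma overlap_le_M: "overlap x \<le> M"
  using overlap_le by (simp add: overlap_def)

lemma ennreal_overlap: "ennreal (overlap x) = emeasure lborel (K \<inter> (+) x ` N)"
proof -
  have "emeasure lebesgue (K \<inter> (+) x ` N) = ennreal (overlap x)"
    unfolding overlap_def
    using lmeasurable_compact[OF compact_overlap] by (intro emeasure_eq_measure2)
  then show ?thesis
    by (simp add: emeasure_lebesgue_borel borel_compact compact_overlap)
qed

lemma interior_overlap:
  assumes "0 < overlap x"
  shows "interior (K \<inter> (+) x ` N) \<noteq> {}"
proof -
  have "\<not> negligible (K \<inter> (+) x ` N)"
    using assms by (auto simp: overlap_def negligible_iff_measure)
  then show ?thesis using negligible_convex_interior[OF convex_overlap] by metis
qed

lemma interior_KN: "interior (K \<inter> N) \<noteq> {}"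
  using interior_overlap[of 0] max_pos by (simp add: overlap_def)

lemma compact_D: "compact D"
  by (rule compact_difference_body[OF compact_K compact_N])

lemma convex_D: "convex D"
  by (rule convex_difference_body[OF convex_K convex_N])

lemma zero_in_interior_D: "0 \<in> interior D"
  by (rule zero_in_interior_difference_body[OF interior_KN])

lemma zero_in_D: "0 \<in> D"
  using zero_in_interior_D interior_subset by auto

lemma overlap_pos_D: "0 < overlap x \<Longrightarrow> x \<in> D"
  by (auto simp: difference_body_iff overlap_def)

text \<open>Translating \<open>(1 - r) a + r p\<close> by \<open>-r x\<close> gives
  \<open>(1 - r) a + r (p - x)\<close>, a convex combination of points of \<open>N\<close>.\<close>

lemma homothet_subset_overlap:
  assumes "p \<in> K \<inter> (+) x ` N" "0 \<le> r" "r \<le> 1"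
  shows "(\<lambda>a. (1 - r) *\<^sub>R a + r *\<^sub>R p) ` (K \<inter> N) \<subseteq> K \<inter> (+) (r *\<^sub>R x) ` N"
proof (intro image_subsetI)
  fix a assume a: "a \<in> K \<inter> N"
  have p: "p \<in> K" "p - x \<in> N" using assms by (auto simp: mem_plus_image_iff)
  have "(1 - r) *\<^sub>R a + r *\<^sub>R p \<in> K" using convex_K a p assms by (auto intro: convexD)
  moreover have "(1 - r) *\<^sub>R a + r *\<^sub>R (p - x) \<in> N" using convex_N a p assms by (auto intro: convexD)
  ultimately show "(1 - r) *\<^sub>R a + r *\<^sub>R p \<in> K \<inter> (+) (r *\<^sub>R x) ` N"
    by (simp add: mem_plus_image_iff scaleR_right_diff_distrib add_diff_eq)
qed

lemma overlap_scaleR_ge: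
  assumes "x \<in> D" "0 \<le> r" "r \<le> 1"
  shows "(1 - r) ^ DIM('a) * M \<le> overlap (r *\<^sub>R x)"
proof -
  obtain p where p: "p \<in> K \<inter> (+) x ` N" using assms(1) by (auto simp: difference_body_iff)
  have "(1 - r) ^ DIM('a) * M = measure lebesgue ((\<lambda>a. (1 - r) *\<^sub>R a + r *\<^sub>R p) ` (K \<inter> N))"
    using assms by (simp add: measure_lebesgue_homothety)
  also have "\<dots> \<le> overlap (r *\<^sub>R x)"
    unfolding overlap_def
  proof (rule measure_mono_fmeasurable[OF homothet_subset_overlap[OF p assms(2,3)]])
    have "compact ((\<lambda>a. (1 - r) *\<^sub>R a + r *\<^sub>R p) ` (K \<inter> N))"
      by (intro compact_continuous_image continuous_intros compact_Int_KN)
    then show "(\<lambda>a. (1 - r) *\<^sub>R a + r *\<^sub>R p) ` (K \<inter> N) \<in> sets lebesgue"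
      using lmeasurable_compact fmeasurableD by blast
    show "K \<inter> (+) (r *\<^sub>R x) ` N \<in> lmeasurable" using compact_overlap lmeasurable_compact by blast
  qed
  finally show ?thesis .
qed

lemma scaled_D_subset_D:
  assumes "0 \<le> r" "r \<le> 1"
  shows "(*\<^sub>R) r ` D \<subseteq> D"
  using convexD[OF convex_D _ zero_in_D, of _ r "1 - r"] assms by auto

lemma scaled_D_mono:
  assumes "0 \<le> r" "r \<le> t"
  shows "(*\<^sub>R) r ` D \<subseteq> (*\<^sub>R) t ` D"
proof (cases "t = 0")
  case False
  then have "(*\<^sub>R) r ` D = (*\<^sub>R) t ` (*\<^sub>R) (r / t) ` D" by (simp add: image_image)
  also have "\<dots> \<subseteq> (*\<^sub>R) t ` D" using assms
    by (intro image_mono scaled_D_subset_D) (auto simp: divide_le_eq_1)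
  finally show ?thesis .
qed (use assms in auto)

lemma scaled_D_subset_level:
  assumes "0 \<le> s" "s \<le> 1"
  shows "(*\<^sub>R) (1 - s) ` D \<subseteq> level s"
  using overlap_scaleR_ge[of _ "1 - s"] scaled_D_subset_D[of "1 - s"] assms
  by (auto simp: level_def)

text \<open>
  If \<open>ball a \<rho> \<subseteq> K \<inter> (x + N)\<close>, then shrinking this overlap towards \<open>a\<close> by \<open>1 - r\<close> leaves room for
  moving \<open>N\<close> by \<open>r \<rho>\<close>.
\<close>

lemma overlap_near_ge:
  assumes "ball a \<rho> \<subseteq> K \<inter> (+) x ` N" "0 < r" "r \<le> 1" "norm (x' - x) < r * \<rho>"
  shows "(1 - r) ^ DIM('a) * overlap x \<le> overlap x'"
proof -
  have "0 < \<rho>" using assms by (smt (verit) norm_ge_zero zero_less_mult_pos)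
  then have a: "a \<in> K" using assms(1) by auto
  have sub: "(\<lambda>b. (1 - r) *\<^sub>R b + r *\<^sub>R a) ` (K \<inter> (+) x ` N) \<subseteq> K \<inter> (+) x' ` N"
  proof (intro image_subsetI)
    fix b assume b: "b \<in> K \<inter> (+) x ` N"
    have "(1 - r) *\<^sub>R b + r *\<^sub>R a \<in> K" using convex_K a b assms by (auto intro: convexD)
    \<comment> \<open>The displacement \<open>x' - x\<close> is charged to the centre
      \<open>a\<close>, which has weight \<open>r\<close>; there it is magnified by
      \<open>1 / r\<close> and stays within the radius \<open>\<rho>\<close>.\<close>
    moreover have "norm ((1 / r) *\<^sub>R (x' - x)) < \<rho>"
      using assms unfolding norm_scaleR by (simp add: field_simps)
    then have "a - (1 / r) *\<^sub>R (x' - x) \<in> ball a \<rho>" by (simp add: dist_norm)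
    then have "a - (1 / r) *\<^sub>R (x' - x) \<in> (+) x ` N" using assms(1) by blast
    then have "a - (1 / r) *\<^sub>R (x' - x) - x \<in> N" by (simp only: mem_plus_image_iff)
    then have "(1 - r) *\<^sub>R (b - x) + r *\<^sub>R (a - (1 / r) *\<^sub>R (x' - x) - x) \<in> N"
      using convex_N b assms by (auto simp: mem_plus_image_iff intro: convexD)
    moreover have "(1 - r) *\<^sub>R (b - x) + r *\<^sub>R (a - (1 / r) *\<^sub>R (x' - x) - x) = (1 - r) *\<^sub>R b + r *\<^sub>R a - x'"
    proof -
      have "r *\<^sub>R (a - (1 / r) *\<^sub>R (x' - x) - x) = r *\<^sub>R a - (x' - x) - r *\<^sub>R x"
        using assms(2) by (simp add: scaleR_right_diff_distrib)
      then show ?thesis by (simp add: algebra_simps)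
    qed
    ultimately show "(1 - r) *\<^sub>R b + r *\<^sub>R a \<in> K \<inter> (+) x' ` N" by (simp add: mem_plus_image_iff)
  qed
  have "(1 - r) ^ DIM('a) * overlap x = measure lebesgue ((\<lambda>b. (1 - r) *\<^sub>R b + r *\<^sub>R a) ` (K \<inter> (+) x ` N))"
    using assms by (simp add: measure_lebesgue_homothety overlap_def)
  also have "\<dots> \<le> overlap x'"
    unfolding overlap_def
  proof (rule measure_mono_fmeasurable[OF sub])
    have "compact ((\<lambda>b. (1 - r) *\<^sub>R b + r *\<^sub>R a) ` (K \<inter> (+) x ` N))"
      by (intro compact_continuous_image continuous_intros compact_overlap)
    then show "(\<lambda>b. (1 - r) *\<^sub>R b + r *\<^sub>R a) ` (K \<inter> (+) x ` N) \<in> sets lebesgue"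
      using lmeasurable_compact fmeasurableD by blast
    show "K \<inter> (+) x' ` N \<in> lmeasurable" using compact_overlap lmeasurable_compact by blast
  qed
  finally show ?thesis .
qed

text \<open>Lower semicontinuity: an overlap of positive volume contains a ball, so nearby
  translates retain a fraction \<open>(1 - r) ^ n\<close> close to one. This yields measurability
  and, in the equality case, open sets that cannot be null.\<close>

lemma open_overlap_greater:
  assumes "0 \<le> c"
  shows "open {x. c < overlap x}"
  unfolding open_dist
proof
  fix x assume "x \<in> {x. c < overlap x}"
  then have x: "c < overlap x" by simp
  then obtain a where "a \<in> interior (K \<inter> (+) x ` N)"
    using interior_overlap[of x] assms by auto
  then obtain \<rho> where \<rho>: "0 < \<rho>" "ball a \<rho> \<subseteq> K \<inter> (+) x ` N" by (meson mem_interior)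
  have "((\<lambda>r. (1 - r) ^ DIM('a) * overlap x) \<longlongrightarrow> (1 - 0) ^ DIM('a) * overlap x) (at_right 0)"
    by (intro tendsto_intros)
  then have "eventually (\<lambda>r. c < (1 - r) ^ DIM('a) * overlap x) (at_right 0)"
    using x by (intro order_tendstoD(1)) auto
  moreover have "eventually (\<lambda>r. r \<in> {0<..<1::real}) (at_right 0)"
    by (intro eventually_at_right_real) simp
  ultimately have "eventually (\<lambda>r. c < (1 - r) ^ DIM('a) * overlap x \<and> r \<in> {0<..<1}) (at_right 0)"
    by (rule eventually_conj)
  then obtain r where r: "c < (1 - r) ^ DIM('a) * overlap x" "0 < r" "r < 1"
    using eventually_happens[of _ "at_right (0::real)"] by (auto simp: trivial_limit_at_right_real)
  show "\<exists>e>0. \<forall>y. dist y x < e \<longrightarrow> y \<in> {x. c < overlap x}"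
  proof (intro exI[of _ "r * \<rho>"] conjI allI impI)
    show "0 < r * \<rho>" using r \<rho> by simp
    fix y assume "dist y x < r * \<rho>"
    then have "(1 - r) ^ DIM('a) * overlap x \<le> overlap y"
      using r by (intro overlap_near_ge[OF \<rho>(2)]) (auto simp: dist_norm)
    then show "y \<in> {x. c < overlap x}" using r by simp
  qed
qed

lemma overlap_measurable [measurable]: "overlap \<in> borel_measurable borel"
proof (rule borel_measurable_iff_greater[THEN iffD2, rule_format])
  fix c :: real
  show "{w \<in> space borel. c < overlap w} \<in> sets borel"
  proof (cases "0 \<le> c")
    case True
    then show ?thesis using open_overlap_greater by simp
  next
    case False
    then have "{w. c < overlap w} = UNIV" using overlap_nonneg by (smt (verit) Collect_cong UNIV_def)
    then show ?thesis by simp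
  qed
qed

lemma level_eq:
  assumes "0 < s"
  shows "level s = {x. s ^ DIM('a) * M \<le> overlap x}"
proof -
  have "0 < s ^ DIM('a) * M" using assms max_pos by simp
  then show ?thesis using overlap_pos_D by (fastforce simp: level_def)
qed

lemma level_borel: "0 < s \<Longrightarrow> level s \<in> sets borel"
  by (simp add: level_eq)

section \<open>Layer-cake integration and the volume inequality\<close>

text \<open>Fubini: for fixed \<open>y\<close> in \<open>K\<close> the admissible \<open>x\<close>
  fill the reflected set \<open>y - N\<close>.\<close>

lemma nn_integral_overlap:
  "(\<integral>\<^sup>+x. ennreal (overlap x) \<partial>lborel) = emeasure lebesgue K * emeasure lebesgue N"
proof -
  have [measurable]: "K \<in> sets borel" "N \<in> sets borel"
    using compact_K compact_N borel_compact by auto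
  have "(\<integral>\<^sup>+x. ennreal (overlap x) \<partial>lborel)
     = (\<integral>\<^sup>+x. (\<integral>\<^sup>+y. indicator K y * indicator N (y - x) \<partial>lborel) \<partial>lborel)"
  proof (rule nn_integral_cong)
    fix x
    have "(\<integral>\<^sup>+y. indicator K y * indicator N (y - x) \<partial>lborel)
        = (\<integral>\<^sup>+y. indicator (K \<inter> (+) x ` N) y \<partial>lborel)"
      by (intro nn_integral_cong) (auto simp: indicator_def mem_plus_image_iff)
    also have "\<dots> = emeasure lborel (K \<inter> (+) x ` N)"
      by (rule nn_integral_indicator) (simp add: borel_compact compact_overlap)
    finally show "ennreal (overlap x) = (\<integral>\<^sup>+y. indicator K y * indicator N (y - x) \<partial>lborel)"
      by (simp add: ennreal_overlap)
  qed
  also have "\<dots> = (\<integral>\<^sup>+y. (\<integral>\<^sup>+x. indicator K y * indicator N (y - x) \<partial>lborel) \<partial>lborel)"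
    by (rule lborel_pair.Fubini'[symmetric]) measurable
  also have "\<dots> = (\<integral>\<^sup>+y. indicator K y * emeasure lebesgue N \<partial>lborel)"
  proof (rule nn_integral_cong)
    fix y
    have c: "compact ((\<lambda>z. y - z) ` N)"
      by (intro compact_continuous_image continuous_intros compact_N)
    have "(\<integral>\<^sup>+x. indicator K y * indicator N (y - x) \<partial>lborel)
        = indicator K y * (\<integral>\<^sup>+x. indicator N (y - x) \<partial>lborel)"
      by (rule nn_integral_cmult) measurable
    also have "(\<integral>\<^sup>+x. indicator N (y - x) \<partial>lborel) = (\<integral>\<^sup>+x. indicator ((\<lambda>z. y - z) ` N) x \<partial>lborel)"
      by (intro nn_integral_cong) (force simp: indicator_def image_iff)
    also have "\<dots> = emeasure lborel ((\<lambda>z. y - z) ` N)"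
      by (rule nn_integral_indicator) (use c borel_compact in simp)
    also have "\<dots> = emeasure lebesgue N"
      unfolding emeasure_lebesgue_borel[OF borel_compact[OF c], symmetric]
      by (rule emeasure_lebesgue_reflect)
    finally show "(\<integral>\<^sup>+x. indicator K y * indicator N (y - x) \<partial>lborel) = indicator K y * emeasure lebesgue N" .
  qed
  also have "\<dots> = (\<integral>\<^sup>+y. indicator K y \<partial>lborel) * emeasure lebesgue N"
    by (rule nn_integral_multc) measurable
  also have "(\<integral>\<^sup>+y. indicator K y \<partial>lborel) = emeasure lebesgue K"
    by (subst nn_integral_indicator) (auto simp only: emeasure_lebesgue_borel sets_lborel \<open>K \<in> sets borel\<close>)
  finally show ?thesis .
qed

text \<open>\<open>overlap x / M\<close> lies between \<open>0\<close> and \<open>1\<close>, hence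
  is itself an integral of the layer weight; exchanging the integrals produces the levels. The same
  double integral shows measurability in \<open>s\<close>.\<close>

lemma nn_integral_overlap_layers:
  "(\<integral>\<^sup>+x. ennreal (overlap x / M) \<partial>lborel) = (\<integral>\<^sup>+s. layer_weight DIM('a) s * emeasure lebesgue (level s) \<partial>lborel)"
  and level_measurable: "(\<lambda>s. layer_weight DIM('a) s * emeasure lebesgue (level s)) \<in> borel_measurable lborel"
proof -
  let ?g = "\<lambda>x s. layer_weight DIM('a) s * indicator {s. s ^ DIM('a) \<le> overlap x / M} s"
  have [measurable]: "(\<lambda>(x, s). ?g x s) \<in> borel_measurable (lborel \<Otimes>\<^sub>M lborel)"
    unfolding indicator_def by measurable
  have inner: "(\<integral>\<^sup>+x. ?g x s \<partial>lborel) = layer_weight DIM('a) s * emeasure lebesgue (level s)" for s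
  proof (cases "s \<in> {0<..<1}")
    case True
    have "(\<integral>\<^sup>+x. ?g x s \<partial>lborel) = (\<integral>\<^sup>+x. layer_weight DIM('a) s * indicator (level s) x \<partial>lborel)"
      using True max_pos
      by (intro nn_integral_cong) (auto simp: indicator_def level_eq field_simps)
    also have "\<dots> = layer_weight DIM('a) s * emeasure lborel (level s)"
      using True by (simp add: nn_integral_cmult_indicator level_borel)
    finally show ?thesis using True by (simp add: emeasure_lebesgue_borel level_borel)
  qed auto
  have "(\<integral>\<^sup>+x. ennreal (overlap x / M) \<partial>lborel) = (\<integral>\<^sup>+x. (\<integral>\<^sup>+s. ?g x s \<partial>lborel) \<partial>lborel)"
    using max_pos overlap_nonneg overlap_le_M
    by (intro nn_integral_cong nn_integral_layer_weight[symmetric]) auto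
  also have "\<dots> = (\<integral>\<^sup>+s. (\<integral>\<^sup>+x. ?g x s \<partial>lborel) \<partial>lborel)"
    by (rule lborel_pair.Fubini'[symmetric]) measurable
  finally show "(\<integral>\<^sup>+x. ennreal (overlap x / M) \<partial>lborel) = (\<integral>\<^sup>+s. layer_weight DIM('a) s * emeasure lebesgue (level s) \<partial>lborel)"
    unfolding inner .
  have "(\<lambda>s. \<integral>\<^sup>+x. ?g x s \<partial>lborel) \<in> borel_measurable lborel" by measurable
  then show "(\<lambda>s. layer_weight DIM('a) s * emeasure lebesgue (level s)) \<in> borel_measurable lborel"
    unfolding inner .
qed

lemma closed_rescaled_levels: "closed rescaled_levels"
  by (simp add: rescaled_levels_def)

lemma level_subset_scaled:
  assumes "0 \<le> s" "s < 1"
  shows "level s \<subseteq> (*\<^sub>R) (1 - s) ` rescaled_levels"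
proof
  fix x assume "x \<in> level s"
  then have "x /\<^sub>R (1 - s) \<in> (\<Union>s\<in>{0..<1}. (\<lambda>x. x /\<^sub>R (1 - s)) ` level s)"
    using assms by auto
  then have "x /\<^sub>R (1 - s) \<in> rescaled_levels"
    unfolding rescaled_levels_def by (rule subsetD[OF closure_subset])
  moreover have "x = (1 - s) *\<^sub>R (x /\<^sub>R (1 - s))" using assms by simp
  ultimately show "x \<in> (*\<^sub>R) (1 - s) ` rescaled_levels" by blast
qed

lemma emeasure_level_le:
  assumes "0 \<le> s" "s < 1"
  shows "emeasure lebesgue (level s) \<le> ennreal ((1 - s) ^ DIM('a)) * emeasure lebesgue rescaled_levels"
proof -
  have "closed ((*\<^sub>R) (1 - s) ` rescaled_levels)"
    using closed_rescaled_levels by (rule closed_scaling)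
  then have "emeasure lebesgue (level s) \<le> emeasure lebesgue ((*\<^sub>R) (1 - s) ` rescaled_levels)"
    by (intro emeasure_mono level_subset_scaled assms) (simp add: borel_closed)
  then show ?thesis using assms by (simp add: emeasure_lebesgue_scaling)
qed

lemma nn_integral_levels:
  "(\<integral>\<^sup>+s. layer_weight DIM('a) s * emeasure lebesgue (level s) \<partial>lborel)
     = ennreal (measure lebesgue K * measure lebesgue N / M)"
proof -
  have "(\<integral>\<^sup>+x. ennreal (overlap x / M) \<partial>lborel) = (\<integral>\<^sup>+x. ennreal (1 / M) * ennreal (overlap x) \<partial>lborel)"
    using max_pos overlap_nonneg by (intro nn_integral_cong) (simp flip: ennreal_mult)
  also have "\<dots> = ennreal (1 / M) * (emeasure lebesgue K * emeasure lebesgue N)"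
    by (subst nn_integral_cmult) (simp_all add: nn_integral_overlap)
  also have "emeasure lebesgue K = ennreal (measure lebesgue K)"
    using lmeasurable_compact[OF compact_K] by (intro emeasure_eq_measure2)
  also have "emeasure lebesgue N = ennreal (measure lebesgue N)"
    using lmeasurable_compact[OF compact_N] by (intro emeasure_eq_measure2)
  finally show ?thesis
    using max_pos by (simp add: nn_integral_overlap_layers flip: ennreal_mult)
qed

text \<open>Meant for \<open>c\<close> the volume of \<open>rescaled_levels\<close>, which may be
  infinite; hence \<open>c\<close> is an extended real.\<close>

lemma nn_integral_shrinking:
  "(\<integral>\<^sup>+s. layer_weight DIM('a) s * (ennreal ((1 - s) ^ DIM('a)) * c) \<partial>lborel)
     = ennreal (1 / real ((2 * DIM('a)) choose DIM('a))) * c"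
proof -
  have "(\<integral>\<^sup>+s. layer_weight DIM('a) s * (ennreal ((1 - s) ^ DIM('a)) * c) \<partial>lborel)
     = (\<integral>\<^sup>+s. layer_weight DIM('a) s * ennreal ((1 - s) ^ DIM('a)) * c \<partial>lborel)"
    by (simp add: mult.assoc)
  also have "\<dots> = (\<integral>\<^sup>+s. layer_weight DIM('a) s * ennreal ((1 - s) ^ DIM('a)) \<partial>lborel) * c"
    by (rule nn_integral_multc) measurable
  also have "(\<integral>\<^sup>+s. layer_weight DIM('a) s * ennreal ((1 - s) ^ DIM('a)) \<partial>lborel)
      = ennreal (1 / real ((2 * DIM('a)) choose DIM('a)))"
    by (rule nn_integral_layer_weight_Beta) simp
  finally show ?thesis .
qed

lemma weight_level_le:
  "layer_weight DIM('a) s * emeasure lebesgue (level s)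
     \<le> layer_weight DIM('a) s * (ennreal ((1 - s) ^ DIM('a)) * emeasure lebesgue rescaled_levels)"
  by (cases "s \<in> {0<..<1}") (auto intro!: mult_left_mono emeasure_level_le)

text \<open>The bound before the scaling by \<open>1/n\<close>; the factor \<open>1/n^n\<close>
  enters with that scaling.\<close>

abbreviation "volume_bound \<equiv>
  ennreal (real ((2 * DIM('a)) choose DIM('a)) * (measure lebesgue K * measure lebesgue N / M))"

lemma volume_bound_eq_iff:
  "ennreal (measure lebesgue K * measure lebesgue N / M)
      = ennreal (1 / real ((2 * DIM('a)) choose DIM('a))) * c \<longleftrightarrow> c = volume_bound" (is "?A = ?i * c \<longleftrightarrow> _")
  and volume_bound_le_iff:
  "ennreal (measure lebesgue K * measure lebesgue N / M)
      \<le> ennreal (1 / real ((2 * DIM('a)) choose DIM('a))) * c \<longleftrightarrow> volume_bound \<le> c"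
proof -
  define b where "b = real ((2 * DIM('a)) choose DIM('a))"
  have b: "0 < b" by (simp add: b_def)
  have inv: "ennreal b * (ennreal (1 / b) * c) = c" "ennreal (1 / b) * (ennreal b * c) = c" for c
    using b by (simp_all flip: mult.assoc ennreal_mult)
  have bound: "volume_bound = ennreal (real ((2 * DIM('a)) choose DIM('a))) * ?A"
    unfolding b_def by (rule ennreal_mult') simp
  show "?A = ?i * c \<longleftrightarrow> c = volume_bound"
    unfolding bound unfolding b_def[symmetric] using inv[of ?A] inv[of c] by auto
  show "?A \<le> ?i * c \<longleftrightarrow> volume_bound \<le> c"
    unfolding bound unfolding b_def[symmetric]
    using inv mult_left_mono[of ?A "ennreal (1 / b) * c" "ennreal b"]
      mult_left_mono[of "ennreal b * ?A" c "ennreal (1 / b)"] by auto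
qed

text \<open>Each level lies in \<open>(1 - s)\<close> times \<open>rescaled_levels\<close>; the
  volumes are integrated against the layer weight.\<close>

theorem emeasure_rescaled_levels_ge: "volume_bound \<le> emeasure lebesgue rescaled_levels"
proof -
  have "(\<integral>\<^sup>+s. layer_weight DIM('a) s * emeasure lebesgue (level s) \<partial>lborel)
      \<le> (\<integral>\<^sup>+s. layer_weight DIM('a) s * (ennreal ((1 - s) ^ DIM('a)) * emeasure lebesgue rescaled_levels) \<partial>lborel)"
    by (intro nn_integral_mono weight_level_le)
  then show ?thesis
    by (simp only: nn_integral_levels nn_integral_shrinking volume_bound_le_iff)
qed

section \<open>Consequences of equality in the volume inequality\<close>

text \<open>The two integrands are ordered and have the same finite integral, so they agree for
  almost every \<open>s\<close>, hence somewhere in every interval of positive length.\<close>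

lemma equality_homothetic_levels:
  assumes eq: "emeasure lebesgue rescaled_levels = volume_bound" and ab: "0 \<le> a" "a < b" "b \<le> 1"
  obtains s where "a < s" "s < b"
    "emeasure lebesgue (level s) = ennreal ((1 - s) ^ DIM('a)) * emeasure lebesgue rescaled_levels"
proof -
  let ?f = "\<lambda>s. layer_weight DIM('a) s * emeasure lebesgue (level s)"
  let ?g = "\<lambda>s. layer_weight DIM('a) s * (ennreal ((1 - s) ^ DIM('a)) * emeasure lebesgue rescaled_levels)"
  have int: "integral\<^sup>N lborel ?f = integral\<^sup>N lborel ?g"
    using eq by (simp only: nn_integral_levels nn_integral_shrinking volume_bound_eq_iff)
  have "AE s in lborel. ?f s = ?g s"
  proof (rule AE_eq_of_nn_integral_eq)
    show "integral\<^sup>N lborel ?g < \<infinity>"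
      unfolding int[symmetric] nn_integral_levels by simp
  qed (use level_measurable weight_level_le int in auto)
  have "\<exists>s. a < s \<and> s < b \<and> ?f s = ?g s"
  proof (rule ccontr)
    assume "\<not> ?thesis"
    then have "AE s in lborel. s \<notin> {a<..<b}"
      using \<open>AE s in lborel. ?f s = ?g s\<close> by (auto elim: AE_mp)
    then have "{a<..<b} \<in> null_sets lborel"
      by (subst (asm) AE_iff_null_sets[symmetric]) auto
    then show False using ab by (simp add: null_sets_def)
  qed
  then obtain s where s: "a < s" "s < b" "?f s = ?g s" by blast
  have "layer_weight DIM('a) s \<noteq> 0" "layer_weight DIM('a) s \<noteq> top"
    using s ab by (auto simp: ennreal_mult_eq_top_iff)
  then have "emeasure lebesgue (level s) = ennreal ((1 - s) ^ DIM('a)) * emeasure lebesgue rescaled_levels"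
    using s(3) by (simp add: ennreal_mult_cancel_left)
  then show ?thesis using that s by blast
qed

text \<open>Levels are contained in \<open>D\<close>, and for some \<open>s\<close> arbitrarily
  close to \<open>0\<close> their volume is \<open>(1 - s) ^ n\<close> times that of
  \<open>rescaled_levels\<close>.\<close>

lemma equality_emeasure_rescaled_levels_le:
  assumes eq: "emeasure lebesgue rescaled_levels = volume_bound"
  shows "emeasure lebesgue rescaled_levels \<le> emeasure lebesgue D"
proof (rule ccontr)
  assume gt: "\<not> emeasure lebesgue rescaled_levels \<le> emeasure lebesgue D"
  define c where "c = real ((2 * DIM('a)) choose DIM('a)) * (measure lebesgue K * measure lebesgue N / M)"
  have c: "emeasure lebesgue rescaled_levels = ennreal c" "0 \<le> c"
    using eq max_pos by (simp_all add: c_def)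
  have D: "emeasure lebesgue D = ennreal (measure lebesgue D)"
    using lmeasurable_compact[OF compact_D] by (intro emeasure_eq_measure2)
  have lt: "measure lebesgue D < c" using gt c D by (simp add: not_le ennreal_less_iff)
  have "((\<lambda>s. (1 - s) ^ DIM('a) * c) \<longlongrightarrow> (1 - 0) ^ DIM('a) * c) (at_right 0)"
    by (intro tendsto_intros)
  then have "eventually (\<lambda>s. measure lebesgue D < (1 - s) ^ DIM('a) * c) (at_right 0)"
    using lt by (intro order_tendstoD(1)) auto
  then obtain b where b: "0 < b" "\<And>s. 0 < s \<Longrightarrow> s < b \<Longrightarrow> measure lebesgue D < (1 - s) ^ DIM('a) * c"
    by (auto simp: eventually_at_right_field)
  obtain s where s: "0 < s" "s < min b 1"
    "emeasure lebesgue (level s) = ennreal ((1 - s) ^ DIM('a)) * emeasure lebesgue rescaled_levels"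
    using equality_homothetic_levels[OF eq, of 0 "min b 1"] b by auto
  have "emeasure lebesgue (level s) \<le> emeasure lebesgue D"
    by (intro emeasure_mono) (use compact_D in \<open>auto simp: level_def borel_compact\<close>)
  then have "ennreal ((1 - s) ^ DIM('a) * c) \<le> ennreal (measure lebesgue D)"
    using s c D by (simp add: ennreal_mult)
  then have "(1 - s) ^ DIM('a) * c \<le> measure lebesgue D" by simp
  then show False using b(2)[of s] s by simp
qed

text \<open>For suitable \<open>s\<close> just above \<open>1 - r\<close> the sets
  \<open>level s\<close> and \<open>(1 - s) D\<close> differ by a null set. Too large an overlap at
  \<open>r x\<close> would put a nonempty open set into this difference: \<open>r x\<close> is
  outside \<open>(1 - s) D\<close>, because \<open>x\<close> is on the frontier and
  \<open>r > 1 - s\<close>.\<close>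

lemma equality_overlap_le:
  assumes eq: "emeasure lebesgue rescaled_levels = volume_bound"
    and x: "x \<in> frontier D" and r: "0 < r" "r < 1"
  shows "overlap (r *\<^sub>R x) \<le> (1 - r) ^ DIM('a) * M"
proof (rule ccontr)
  assume "\<not> ?thesis"
  then have "(1 - r) ^ DIM('a) * M < overlap (r *\<^sub>R x)" by (simp only: not_le)
  moreover have "((\<lambda>t. t ^ DIM('a) * M) \<longlongrightarrow> (1 - r) ^ DIM('a) * M) (at_right (1 - r))"
    by (intro tendsto_intros)
  ultimately have "eventually (\<lambda>t. t ^ DIM('a) * M < overlap (r *\<^sub>R x)) (at_right (1 - r))"
    by (intro order_tendstoD(2)) auto
  then obtain b where b: "1 - r < b"
    "\<And>t. 1 - r < t \<Longrightarrow> t < b \<Longrightarrow> t ^ DIM('a) * M < overlap (r *\<^sub>R x)"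
    by (auto simp: eventually_at_right_field)
  \<comment> \<open>\<open>t < b\<close> keeps \<open>r x\<close> in the open superlevel set for
    \<open>t\<close>, and \<open>s\<close> is found below \<open>t\<close>, so that this set is
    contained in \<open>level s\<close>.\<close>
  define t where "t = (1 - r + min b 1) / 2"
  have t: "1 - r < t" "t < b" "t < 1" using b r by (auto simp: t_def min_def)
  obtain s where s: "1 - r < s" "s < t"
    "emeasure lebesgue (level s) = ennreal ((1 - s) ^ DIM('a)) * emeasure lebesgue rescaled_levels"
    using equality_homothetic_levels[OF eq, of "1 - r" t] t r by auto
  have s01: "0 < s" "s < 1" using s r t by auto
  let ?E = "(*\<^sub>R) (1 - s) ` D"
  have cE: "compact ?E" using compact_D by (rule compact_scaling)
  have mE: "?E \<in> sets lebesgue" "emeasure lebesgue ?E < \<infinity>"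
    using lmeasurable_compact[OF cE] by (auto simp: fmeasurable_def)
  have mL: "level s \<in> sets lebesgue" using level_borel s01 by simp
  have "emeasure lebesgue (level s) \<le> emeasure lebesgue ?E"
    using s equality_emeasure_rescaled_levels_le[OF eq] s01
    by (simp add: emeasure_lebesgue_scaling mult_left_mono)
  moreover have "emeasure lebesgue (level s - ?E) = emeasure lebesgue (level s) - emeasure lebesgue ?E"
    by (rule emeasure_Diff) (use mE mL scaled_D_subset_level[of s] s01 in auto)
  ultimately have "emeasure lebesgue (level s - ?E) = 0"
    using mE(2) by (auto simp only: infinity_ennreal_def intro!: diff_eq_0_ennreal elim: le_less_trans)
  then have null: "negligible (level s - ?E)"
    using mE mL by (simp add: negligible_iff_null_sets null_sets_def)
  let ?U = "{y. t ^ DIM('a) * M < overlap y} - ?E"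
  have "open ?U"
    using open_overlap_greater cE t r max_pos by (intro open_Diff compact_imp_closed) auto
  moreover have "?U \<subseteq> level s - ?E"
  proof -
    have "s ^ DIM('a) * M \<le> t ^ DIM('a) * M"
      using s s01 max_pos by (intro mult_right_mono power_mono) auto
    then show ?thesis using s01 by (auto simp: level_eq)
  qed
  then have "negligible ?U" using null negligible_subset by blast
  moreover have "r *\<^sub>R x \<in> ?U"
  proof -
    have "r *\<^sub>R x \<notin> ?E"
    proof
      assume "r *\<^sub>R x \<in> ?E"
      then obtain d where d: "d \<in> D" "r *\<^sub>R x = (1 - s) *\<^sub>R d" by auto
      have "(r / (1 - s)) *\<^sub>R x = (1 / (1 - s)) *\<^sub>R (r *\<^sub>R x)" by simp
      also have "\<dots> = d" unfolding d(2) using s01 by simp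
      finally have "(r / (1 - s)) *\<^sub>R x \<in> closure D" using d closure_subset by auto
      moreover have "1 < r / (1 - s)" using s s01 by simp
      ultimately show False
        using scaled_frontier_notin_closure[OF convex_D zero_in_interior_D x] by blast
    qed
    then show ?thesis using b(2)[OF t(1,2)] by simp
  qed
  ultimately show False using open_not_negligible by blast
qed

text \<open>The overlap at \<open>r x\<close> contains a homothet of \<open>K \<inter> N\<close> of
  the same volume, hence equals it. This holds for every point \<open>p\<close> of
  \<open>K \<inter> (x + N)\<close>, which forces \<open>p\<close> to be unique.\<close>

theorem equality_homothetic_overlaps:
  assumes eq: "emeasure lebesgue rescaled_levels = volume_bound"
  shows "homothetic_overlaps K N"
  unfolding homothetic_overlaps_def
proof
  fix x assume x: "x \<in> frontier D"
  have hom: "K \<inter> (+) (r *\<^sub>R x) ` N = (\<lambda>a. (1 - r) *\<^sub>R a + r *\<^sub>R p) ` (K \<inter> N)"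
    if p: "p \<in> K \<inter> (+) x ` N" and r: "0 < r" "r < 1" for p r
  proof (rule convex_eq_of_measure_le)
    let ?S = "(\<lambda>a. (1 - r) *\<^sub>R a + r *\<^sub>R p) ` (K \<inter> N)"
    show "?S \<subseteq> K \<inter> (+) (r *\<^sub>R x) ` N" 
      by (rule homothet_subset_overlap[OF p]) (use r in auto)
    show "compact ?S" by (intro compact_continuous_image continuous_intros compact_Int_KN)
    have m: "measure lebesgue ?S = (1 - r) ^ DIM('a) * M"
      using r by (simp add: measure_lebesgue_homothety)
    then show "measure lebesgue (K \<inter> (+) (r *\<^sub>R x) ` N) \<le> measure lebesgue ?S"
      using equality_overlap_le[OF eq x r] by (simp add: overlap_def)
    have "x \<in> D" using p by (auto simp: difference_body_iff)
    then have "(1 - r) ^ DIM('a) * M \<le> overlap (r *\<^sub>R x)"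
      using r by (intro overlap_scaleR_ge) auto
    moreover have "0 < (1 - r) ^ DIM('a) * M" using r max_pos by simp
    ultimately show "interior (K \<inter> (+) (r *\<^sub>R x) ` N) \<noteq> {}" by (intro interior_overlap) auto
  qed (rule convex_overlap compact_overlap)+
  have "x \<in> D" using x compact_D frontier_subset_compact by blast
  then obtain p where p: "p \<in> K \<inter> (+) x ` N" by (auto simp: difference_body_iff)
  \<comment> \<open>At \<open>r = 1/2\<close> the homothets for \<open>p\<close> and
    \<open>q\<close> are the same set, yet they are translates of each other by
    \<open>(q - p) / 2\<close>.\<close>
  have "q = p" if q: "q \<in> K \<inter> (+) x ` N" for q
  proof -
    let ?S = "\<lambda>p. (\<lambda>a. (1 - 1/2) *\<^sub>R a + (1/2) *\<^sub>R p) ` (K \<inter> N)"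
    have "?S q = ?S p" using hom[OF p, of "1/2"] hom[OF q, of "1/2"] by simp
    moreover have "(+) ((1/2) *\<^sub>R (q - p)) ` ?S p = ?S q"
      unfolding image_image by (intro image_cong refl) (simp add: algebra_simps)
    moreover have "compact (?S p)"
      by (intro compact_continuous_image continuous_intros compact_Int_KN)
    moreover have "?S p \<noteq> {}" using interior_KN interior_subset by blast
    ultimately have "(1/2) *\<^sub>R (q - p) = 0" using compact_translation_eqD by metis
    then show ?thesis by simp
  qed
  then have "K \<inter> (+) x ` N = {p}" using p by blast
  then show "\<exists>p. K \<inter> (+) x ` N = {p} \<and>
      (\<forall>r\<in>{0<..<1}. K \<inter> (+) (r *\<^sub>R x) ` N = (\<lambda>a. (1 - r) *\<^sub>R a + r *\<^sub>R p) ` (K \<inter> N))"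
    using hom[OF p] by (intro exI[of _ p]) auto
qed

section \<open>Simplices attain equality\<close>

text \<open>Barycentric coordinates give \<open>r\<close> such that \<open>x\<close> lies in
  \<open>(1 - r) D\<close> and the overlap at \<open>x\<close> is at most \<open>r ^ n * M\<close>.
  On \<open>level s\<close> this means \<open>s \<le> r\<close>.\<close>

lemma simplex_level_eq:
  assumes KN: "K = N" and "m simplex K" and s: "0 \<le> s" "s \<le> 1"
  shows "level s = (*\<^sub>R) (1 - s) ` D"
proof
  show "level s \<subseteq> (*\<^sub>R) (1 - s) ` D"
  proof
    fix x assume x: "x \<in> level s"
    then have "x \<in> D" by (simp add: level_def)
    then have "x \<in> difference_body K K" using KN by simp
    then obtain r p where r: "0 \<le> r" "r \<le> 1" "K \<inter> (+) x ` K \<subseteq> (\<lambda>k. r *\<^sub>R k + p) ` K"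
      "x \<in> (*\<^sub>R) (1 - r) ` difference_body K K"
      using simplex_overlap[OF assms(2)] by metis
    have "compact ((\<lambda>k. r *\<^sub>R k + p) ` K)"
      by (intro compact_continuous_image continuous_intros compact_K)
    then have "overlap x \<le> measure lebesgue ((\<lambda>k. r *\<^sub>R k + p) ` K)"
      unfolding overlap_def
      using compact_overlap[of x] r(3)[unfolded KN] KN lmeasurable_compact
      by (intro measure_mono_fmeasurable) (auto intro: fmeasurableD)
    also have "\<dots> = r ^ DIM('a) * M"
      using r KN by (simp add: measure_lebesgue_homothety)
    finally have "s ^ DIM('a) * M \<le> r ^ DIM('a) * M" using x by (simp add: level_def)
    then have "s ^ DIM('a) \<le> r ^ DIM('a)" using max_pos by simp
    then have "s \<le> r" using r(1) s(1) by (simp add: power_mono_iff)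
    then show "x \<in> (*\<^sub>R) (1 - s) ` D"
      using r scaled_D_mono[of "1 - r" "1 - s"] KN by auto
  qed
qed (rule scaled_D_subset_level[OF s])

text \<open>All rescaled levels coincide with \<open>D\<close>, so the integrands of the volume
  inequality agree at every \<open>s\<close>.\<close>

theorem simplex_equality:
  assumes KN: "K = N" and simplex: "m simplex K"
  shows "emeasure lebesgue rescaled_levels = volume_bound"
proof -
  have "(\<lambda>x. x /\<^sub>R (1 - s)) ` level s = D" if "s \<in> {0..<1}" for s
    using that simplex_level_eq[OF assms, of s] by (simp add: image_image)
  then have "rescaled_levels = closure (\<Union>s\<in>{0..<1::real}. D)"
    unfolding rescaled_levels_def by simp
  then have cone: "rescaled_levels = D" using compact_D by (simp add: compact_imp_closed)
  have "layer_weight DIM('a) s * emeasure lebesgue (level s)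
      = layer_weight DIM('a) s * (ennreal ((1 - s) ^ DIM('a)) * emeasure lebesgue rescaled_levels)" for s
    using simplex_level_eq[OF assms, of s]
    by (cases "s \<in> {0<..<1}") (simp_all add: cone emeasure_lebesgue_scaling)
  then have "(\<integral>\<^sup>+s. layer_weight DIM('a) s * emeasure lebesgue (level s) \<partial>lborel)
      = (\<integral>\<^sup>+s. layer_weight DIM('a) s * (ennreal ((1 - s) ^ DIM('a)) * emeasure lebesgue rescaled_levels) \<partial>lborel)"
    by simp
  then show ?thesis
    by (simp only: nn_integral_levels nn_integral_shrinking volume_bound_eq_iff)
qed

corollary emeasure_rescaled_levels_eq_iff:
  "emeasure lebesgue rescaled_levels = volume_bound \<longleftrightarrow> K = N \<and> int DIM('a) simplex K"
proof
  assume eq: "emeasure lebesgue rescaled_levels = volume_bound"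
  note hom = equality_homothetic_overlaps[OF eq]
  have KN: "K = N"
    using homothetic_overlaps_imp_eq[OF compact_K convex_K compact_N convex_N interior_KN hom] .
  moreover have "int DIM('a) simplex K"
    using homothetic_overlaps_imp_simplex[OF compact_K convex_K] interior_KN hom KN by simp
  ultimately show "K = N \<and> int DIM('a) simplex K" ..
qed (use simplex_equality in blast)

end

section \<open>Passage to the limiting convolution set\<close>

lemma minus_image_eq: "(\<lambda>y. x - y) ` L = (+) x ` uminus ` L" for x :: "'a::euclidean_space"
  by (simp add: image_image)

lemma set_plus_eq_difference_body: "K + L = difference_body K (uminus ` L)"
  by (force simp: difference_body_def set_plus_def)

lemma overlap_max_convex_bodies:
  fixes K L :: "'a::euclidean_space set"
  assumes K: "convex_body K" and L: "convex_body L"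
    and max: "max_conv K L = measure lebesgue (K \<inter> uminus ` L)"
  shows "overlap_max K (uminus ` L)"
proof -
  let ?N = "uminus ` L"
  have K': "compact K" "convex K" "interior K \<noteq> {}" and L': "compact L" "convex L" "interior L \<noteq> {}"
    using K L by (auto simp: convex_body_def)
  have N: "compact ?N" "convex ?N"
    using L' by (auto intro: compact_negations convex_negations)
  have conv: "conv_fun K L x = measure lebesgue (K \<inter> (+) x ` ?N)" for x
    by (simp add: conv_fun_def minus_image_eq)
  have cpt: "compact (K \<inter> (+) x ` ?N)" for x
    using K' N by (simp add: compact_Int compact_translation)
  have bdd: "bdd_above (conv_fun K L ` (K + L))"
    by (intro bdd_aboveI2[of _ _ "measure lebesgue K"])
       (use cpt K' lmeasurable_compact in \<open>auto simp: conv intro!: measure_mono_fmeasurable fmeasurableD\<close>)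
  have le: "measure lebesgue (K \<inter> (+) x ` ?N) \<le> measure lebesgue (K \<inter> ?N)" for x
  proof (cases "x \<in> K + L")
    case True
    then have "conv_fun K L x \<le> max_conv K L"
      unfolding max_conv_def using bdd by (rule cSUP_upper)
    then show ?thesis using max conv by simp
  next
    case False
    then show ?thesis
      by (simp add: set_plus_eq_difference_body difference_body_iff)
  qed
  \<comment> \<open>For interior points \<open>k\<close> and \<open>l\<close> the translate by
    \<open>k + l\<close> has \<open>k\<close> in the interior of the overlap, so the maximal volume
    is positive.\<close>
  obtain k l where kl: "k \<in> interior K" "l \<in> interior L" using K' L' by auto
  have "k \<in> interior (K \<inter> (+) (k + l) ` ?N)"
    using kl by (auto simp: interior_translation interior_negations mem_plus_image_iff image_iff)
  moreover have "convex (K \<inter> (+) (k + l) ` ?N)"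
    using K' N by (simp add: convex_Int convex_translation)
  ultimately have "\<not> negligible (K \<inter> (+) (k + l) ` ?N)"
    using negligible_convex_interior by blast
  then have "measure lebesgue (K \<inter> (+) (k + l) ` ?N) \<noteq> 0"
    using lmeasurable_compact[OF cpt] by (simp add: negligible_iff_measure)
  then have "0 < measure lebesgue (K \<inter> ?N)"
    using le[of "k + l"] measure_nonneg[of lebesgue "K \<inter> (+) (k + l) ` ?N"] by linarith
  then show ?thesis using K' N le by unfold_locales auto
qed

text \<open>The substitution \<open>\<theta> = s ^ n\<close> is a bijection of
  \<open>{0..<1}\<close> onto itself and removes the root.\<close>

lemma limit_conv_set_eq_rescaled_levels:
  fixes K L :: "'a::euclidean_space set"
  assumes "convex_body K" "convex_body L"
    and max: "max_conv K L = measure lebesgue (K \<inter> uminus ` L)"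
  shows "limit_conv_set K L = (\<lambda>x. x /\<^sub>R real DIM('a)) ` overlap_max.rescaled_levels K (uminus ` L)"
proof -
  interpret overlap_max K "uminus ` L" using overlap_max_convex_bodies assms by blast
  have theta: "theta_sum (s ^ DIM('a)) K L = level s" for s
    by (simp add: theta_sum_def level_def max conv_fun_def overlap_def minus_image_eq
        set_plus_eq_difference_body)
  have "(\<Union>\<theta>\<in>{0..<1}. (\<lambda>x. x /\<^sub>R (1 - root DIM('a) \<theta>)) ` theta_sum \<theta> K L)
      = (\<Union>\<theta>\<in>(\<lambda>s. s ^ DIM('a)) ` {0..<1}. (\<lambda>x. x /\<^sub>R (1 - root DIM('a) \<theta>)) ` theta_sum \<theta> K L)"
  proof -
    have "\<theta> \<in> (\<lambda>s. s ^ DIM('a)) ` {0..<1}" if "\<theta> \<in> {0..<1}" for \<theta> :: real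
      using that by (intro image_eqI[of _ _ "root DIM('a) \<theta>"]) auto
    moreover have "s ^ DIM('a) \<in> {0..<1}" if "s \<in> {0..<1}" for s :: real
      using that by (auto simp: power_less_one_iff)
    ultimately have "(\<lambda>s. s ^ DIM('a)) ` {0..<1} = {0..<1::real}" by blast
    then show ?thesis by simp
  qed
  also have "\<dots> = (\<Union>s\<in>{0..<1}. (\<lambda>x. x /\<^sub>R (1 - s)) ` level s)"
    unfolding image_image
    by (intro SUP_cong refl) (simp add: theta real_root_power_cancel)
  finally show ?thesis by (simp add: limit_conv_set_def rescaled_levels_def)
qed

theorem theorem4p6:
  fixes K L :: "(real ^ 'n) set"
  assumes "convex_body K" and "convex_body L"
    and "max_conv K L = measure lebesgue (K \<inter> uminus ` L)"
  shows "emeasure lebesgue (limit_conv_set K L) \<ge>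
           ennreal (real ((2 * CARD('n)) choose CARD('n)) * (1 / real CARD('n) ^ CARD('n)) *
             (measure lebesgue K * measure lebesgue L / max_conv K L))
       \<and> (emeasure lebesgue (limit_conv_set K L) =
           ennreal (real ((2 * CARD('n)) choose CARD('n)) * (1 / real CARD('n) ^ CARD('n)) *
             (measure lebesgue K * measure lebesgue L / max_conv K L))
          \<longleftrightarrow> K = uminus ` L \<and> int CARD('n) simplex K)"
proof -
  interpret overlap_max K "uminus ` L" using overlap_max_convex_bodies assms by blast
  let ?n = "real CARD('n)"
  let ?q = "measure lebesgue K * measure lebesgue L / max_conv K L"
  define b where "b = real ((2 * CARD('n)) choose CARD('n))"
  define i where "i = 1 / ?n ^ CARD('n)"
  have i: "0 < i" by (simp add: i_def)
  have b: "0 \<le> b" by (simp add: b_def)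
  have q: "0 \<le> ?q" using assms(3) by simp
  have L: "measure lebesgue (uminus ` L) = measure lebesgue L"
    using measure_lebesgue_affine[of "-1" 0 L] by simp
  have bound: "volume_bound = ennreal (b * ?q)" by (simp add: b_def L assms(3))
  have rhs: "ennreal (b * i * ?q) = ennreal i * ennreal (b * ?q)"
    using i b q by (subst ennreal_mult[symmetric]) (auto simp only: mult_ac intro!: mult_nonneg_nonneg)
  have "limit_conv_set K L = (*\<^sub>R) (1 / ?n) ` rescaled_levels"
    unfolding limit_conv_set_eq_rescaled_levels[OF assms] by (simp add: inverse_eq_divide)
  then have lhs: "emeasure lebesgue (limit_conv_set K L) = ennreal i * emeasure lebesgue rescaled_levels"
    by (simp add: emeasure_lebesgue_scaling i_def power_one_over)
  \<comment> \<open>The positive finite factor \<open>i\<close> can be cancelled even when the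
    volume is infinite.\<close>
  have cancel: "ennreal i * c \<le> ennreal i * d \<longleftrightarrow> c \<le> d" "ennreal i * c = ennreal i * d \<longleftrightarrow> c = d" for c d
  proof -
    have inv: "ennreal (1 / i) * (ennreal i * c) = c" for c
      using i by (simp flip: mult.assoc ennreal_mult)
    show "ennreal i * c = ennreal i * d \<longleftrightarrow> c = d" using inv by metis
    show "ennreal i * c \<le> ennreal i * d \<longleftrightarrow> c \<le> d"
      using inv mult_left_mono[of "ennreal i * c" "ennreal i * d" "ennreal (1 / i)"]
      by (auto intro: mult_left_mono)
  qed
  show ?thesis
    using emeasure_rescaled_levels_ge emeasure_rescaled_levels_eq_iff
    unfolding b_def[symmetric] i_def[symmetric] rhs lhs cancel bound by simp
qed

end
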